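(* Let $W=\{z\in\mathbb{C}:-1<\operatorname{Re}(z)<1\}$, let $a\in(-1,1)$, and let $T_W$ be the exit time from $W$ of a planar Brownian motion started at $a$. Then the density of $B_{T_W}$ with respect to arclength on the boundary of $W$ is given, for $y\in\mathbb{R}$, by $$\rho^a_{T_W}(1+yi)=\frac1\pi\sum_{j=1}^\infty\frac{(-1)^{j+1}\big((2j-1)+(-1)^ja\big)}{\big((2j-1)+(-1)^ja\big)^2+y^2},\qquad \rho^a_{T_W}(-1+yi)=\frac1\pi\sum_{j=1}^\infty\frac{(-1)^{j+1}\big((2j-1)-(-1)^ja\big)}{\big((2j-1)-(-1)^ja\big)^2+y^2},$$ and also by $$\rho^a_{T_W}(\pm1+yi)=\frac{\operatorname{sech}(\frac\pi2y)\,\big(1-\tan^2(\frac\pi4a)\big)}{4\left(\Big(1\mp\tan(\tfrac\pi4a)\frac{1-\tanh^2(\frac\pi4y)}{1+\tanh^2(\frac\pi4y)}\Big)^2+\Big(\tan(\tfrac\pi4a)\frac{2\tanh(\frac\pi4y)}{1+\tanh^2(\frac\pi4y)}\Big)^2\right)}.$$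
   Context: For a domain $U$, $T_U=\inf\{t\ge0:B_t\notin U\}$, and $\rho^a_{T_U}$ denotes the density of $B_{T_U}$ with respect to arclength on the boundary when $B_0=a$. $\operatorname{sech}=1/\cosh$. *)

theory Defs
  imports "HOL-Probability.Probability"
begin

text \<open>The starting point is prescribed almost surely, all sample paths are continuous; only the
  values of the process at times \<open>t \<ge> 0\<close> matter.\<close>

locale linear_brownian_motion = prob_space M for M :: "'a measure" +
  fixes X :: "real \<Rightarrow> 'a \<Rightarrow> real" and x :: real
  assumes random_variable_X: "0 \<le> t \<Longrightarrow> random_variable borel (X t)"
    and start: "AE \<omega> in M. X 0 \<omega> = x"
    and indep_increments: "mono s \<Longrightarrow> 0 \<le> s 0 \<Longrightarrow>
      indep_vars (\<lambda>_. borel) (\<lambda>i \<omega>. X (s (Suc i)) \<omega> - X (s i) \<omega>) {..<(n::nat)}"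
    and gaussian_increments: "0 \<le> r \<Longrightarrow> r < t \<Longrightarrow>
      distributed M lborel (\<lambda>\<omega>. X t \<omega> - X r \<omega>) (normal_density 0 (sqrt (t - r)))"
    and continuous_paths: "\<omega> \<in> space M \<Longrightarrow> continuous_on {0..} (\<lambda>t. X t \<omega>)"

locale planar_brownian_motion = prob_space M for M :: "'a measure" +
  fixes B :: "real \<Rightarrow> 'a \<Rightarrow> complex" and a :: complex
  assumes Re_brownian: "linear_brownian_motion M (\<lambda>t \<omega>. Re (B t \<omega>)) (Re a)"
    and Im_brownian: "linear_brownian_motion M (\<lambda>t \<omega>. Im (B t \<omega>)) (Im a)"
    and indep_Re_Im:
      "indep_var (Pi\<^sub>M {0..} (\<lambda>_. borel)) (\<lambda>\<omega>. \<lambda>t\<in>{0..}. Re (B t \<omega>))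
                 (Pi\<^sub>M {0..} (\<lambda>_. borel)) (\<lambda>\<omega>. \<lambda>t\<in>{0..}. Im (B t \<omega>))"

text \<open>The exit time is \<open>\<infinity>\<close> on the paths that never leave \<open>U\<close>. On those the exit position has
  the dummy value \<open>B 0 \<omega>\<close>, as \<open>enn2real \<infinity> = 0\<close>; a density of the exit position is therefore only
  considered when the exit time is almost surely finite.\<close>

definition exit_time :: "(real \<Rightarrow> 'a \<Rightarrow> complex) \<Rightarrow> complex set \<Rightarrow> 'a \<Rightarrow> ennreal" where
  "exit_time B U \<omega> = (INF t\<in>{t. 0 \<le> t \<and> B t \<omega> \<notin> U}. ennreal t)"

definition exit_position :: "(real \<Rightarrow> 'a \<Rightarrow> complex) \<Rightarrow> complex set \<Rightarrow> 'a \<Rightarrow> complex" where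
  "exit_position B U \<omega> = B (enn2real (exit_time B U \<omega>)) \<omega>"

text \<open>\<open>\<sigma>\<close> is the arclength measure on the boundary of \<open>U\<close>, seen as a Borel measure on the plane.\<close>

definition is_exit_density ::
  "'a measure \<Rightarrow> (real \<Rightarrow> 'a \<Rightarrow> complex) \<Rightarrow> complex set \<Rightarrow> complex measure \<Rightarrow> (complex \<Rightarrow> real) \<Rightarrow> bool"
where
  "is_exit_density M B U \<sigma> \<rho> \<longleftrightarrow>
     (AE \<omega> in M. exit_time B U \<omega> < \<infinity>) \<and> (\<forall>z. 0 \<le> \<rho> z) \<and>
     distributed M \<sigma> (exit_position B U) (\<lambda>z. ennreal (\<rho> z))"

definition strip :: "complex set" where
  "strip = {z. - 1 < Re z \<and> Re z < 1}"

text \<open>The boundary of the strip consists of the two lines \<open>Re z = 1\<close> and \<open>Re z = - 1\<close>, each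
  parametrised by arclength through \<open>y \<mapsto> x + y \<i>\<close>.\<close>

definition strip_arclength :: "complex measure" where
  "strip_arclength =
     distr (count_space {- 1, 1} \<Otimes>\<^sub>M lborel) borel (\<lambda>(x, y). Complex x y)"

lemma frontier_strip: "frontier strip = {z. Re z = 1 \<or> Re z = - 1}"
proof -
  have "open strip"
    unfolding strip_def
    by (intro open_Collect_conj open_Collect_less continuous_intros)
  moreover have "closure strip = {z. - 1 \<le> Re z \<and> Re z \<le> 1}"
  proof (intro equalityI subsetI)
    have "closed {z. - 1 \<le> Re z \<and> Re z \<le> 1}"
      by (intro closed_Collect_conj closed_Collect_le continuous_intros)
    then have "closure strip \<subseteq> {z. - 1 \<le> Re z \<and> Re z \<le> 1}"
      by (intro closure_minimal) (auto simp: strip_def)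
    then show "z \<in> {z. - 1 \<le> Re z \<and> Re z \<le> 1}" if "z \<in> closure strip" for z
      using that by blast
  next
    fix z assume z: "z \<in> {z. - 1 \<le> Re z \<and> Re z \<le> 1}"
    define w where "w n = (1 - inverse (real (Suc n))) *\<^sub>R z" for n
    have "w \<longlonglongrightarrow> (1 - 0) *\<^sub>R z"
      unfolding w_def by (intro tendsto_intros LIMSEQ_inverse_real_of_nat)
    moreover have "w n \<in> strip" for n
    proof -
      define c where "c = 1 - inverse (real (Suc n))"
      have c: "0 \<le> c" "c < 1" by (simp_all add: c_def inverse_le_1_iff)
      have "\<bar>c * Re z\<bar> \<le> c * 1"
        using z c unfolding abs_mult by (intro mult_mono) auto
      also have "\<dots> < 1" using c by simp
      finally have "\<bar>c * Re z\<bar> < 1" .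
      moreover have "Re (w n) = c * Re z" by (simp add: w_def c_def)
      ultimately show ?thesis by (simp add: strip_def abs_less_iff)
    qed
    ultimately show "z \<in> closure strip"
      unfolding closure_sequential by (intro exI[of _ w]) simp
  qed
  ultimately have "frontier strip = {z. - 1 \<le> Re z \<and> Re z \<le> 1} - strip"
    by (simp add: frontier_def interior_open)
  also have "\<dots> = {z. Re z = 1 \<or> Re z = - 1}"
    unfolding strip_def by (intro set_eqI) (simp, linarith)
  finally show ?thesis .
qed

lemma emeasure_strip_arclength:
  assumes "A \<in> sets borel"
  shows "emeasure strip_arclength A =
    emeasure lborel {y. Complex 1 y \<in> A} + emeasure lborel {y. Complex (- 1) y \<in> A}"
proof -
  let ?P = "count_space {- 1, 1 :: real} \<Otimes>\<^sub>M (lborel :: real measure)"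
  have sec: "(\<lambda>y. Complex x y) \<in> borel_measurable borel" for x
    by (intro borel_measurable_continuous_onI) (auto intro!: continuous_intros simp: Complex_eq)
  have m: "(\<lambda>(x, y). Complex x y) \<in> measurable ?P borel"
    by (rule measurable_pair_measure_countable1) (use sec in auto)
  have "emeasure strip_arclength A = emeasure ?P ((\<lambda>(x, y). Complex x y) -` A \<inter> space ?P)"
    unfolding strip_arclength_def by (rule emeasure_distr[OF m assms])
  also have "\<dots> = (\<integral>\<^sup>+x. emeasure lborel
      (Pair x -` ((\<lambda>(x, y). Complex x y) -` A \<inter> space ?P)) \<partial>count_space {- 1, 1})"
    by (rule lborel.emeasure_pair_measure_alt) (rule measurable_sets[OF m assms])
  also have "\<dots> = (\<integral>\<^sup>+x. emeasure lborel {y. Complex x y \<in> A} \<partial>count_space {- 1, 1})"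
    by (intro nn_integral_cong arg_cong2[where f = emeasure] refl)
      (auto simp: space_pair_measure)
  also have "\<dots> = emeasure lborel {y. Complex 1 y \<in> A} + emeasure lborel {y. Complex (- 1) y \<in> A}"
    by (subst nn_integral_count_space_finite) (auto simp: add.commute)
  finally show ?thesis .
qed

end

theory Submission imports Defs begin

text \<open>Write \<open>B = X + \<i> Y\<close> and let \<open>\<tau>\<close> be the exit time, which is the first time at which \<open>\<bar>X\<bar> = 1\<close>.

  For real \<open>l\<close> the process \<open>exp (l X\<^sub>t - l\<^sup>2 t / 2)\<close> has constant mean, and it is bounded up to time \<open>\<tau>\<close>
  because \<open>\<bar>X\<bar> \<le> 1\<close> there. Stopping it at \<open>\<tau>\<close> gives \<open>E exp (l X\<^sub>\<tau> - l\<^sup>2 \<tau> / 2) = exp (l a)\<close>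
  (\<open>exit_exponential\<close>). The path of \<open>X\<close> determines \<open>\<tau>\<close> and is independent of \<open>Y\<close>, so \<open>exp (- l\<^sup>2 \<tau> / 2)\<close>
  is the conditional characteristic function of \<open>Y\<^sub>\<tau>\<close> at both \<open>l\<close> and \<open>- l\<close>. Hence
  \<open>E (exp (\<plusminus> l X\<^sub>\<tau>) exp (\<i> l Y\<^sub>\<tau>)) = exp (\<plusminus> l a)\<close>, which is the mean value property of the harmonic
  functions \<open>exp (l z)\<close> and \<open>exp (- l cnj z)\<close>. Since \<open>X\<^sub>\<tau>\<close> takes only the values \<open>\<plusminus>1\<close>, these are two linear
  equations for the Fourier transforms of \<open>Y\<^sub>\<tau>\<close> on the two boundary lines; their solution is
  \<open>sinh (l (1 \<plusminus> a)) / sinh (2 l)\<close> (\<open>exit_side_Fourier\<close>).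

  It remains to invert these transforms. A geometric series turns \<open>sinh (l (1 + a)) / sinh (2 l)\<close> into an
  alternating sum of exponentials \<open>exp (- c \<bar>l\<bar>)\<close>, where \<open>c\<close> runs through the distances from the line
  \<open>Re z = 1\<close> to the successive mirror images of \<open>a\<close> in the two boundary lines. Each exponential is the
  Fourier transform of a Cauchy density, and integration term by term gives the first pair of formulas
  (\<open>strip_kernel_Fourier\<close>, \<open>strip_kernel_series\<close>). The partial fraction expansion of the cotangent, obtained
  from the reflection formula of the Gamma function, sums the series to the closed form
  (\<open>strip_kernel_image_sums\<close>). Levy's inversion formula finally shows that a law with this integrable
  Fourier transform has the inverse transform as its density (\<open>density_of_event_Fourier\<close>).\<close>

section \<open>Hitting the boundary along a continuous path\<close>

text \<open>The right-hand side involves only countably many values of \<open>f\<close>, each inner condition only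
  finitely many. It therefore makes the event of a hit before time \<open>r\<close> measurable, also as an event in the
  product space of all paths, and reduces independence from the past to finitely many increments. The
  slack \<open>1 / Suc m\<close> is needed because the grid may miss the hitting times themselves.\<close>
lemma dyadic_hit_iff:
  fixes f :: "real \<Rightarrow> real"
  assumes cont: "continuous_on {0..r} f" and r: "0 \<le> r"
  shows "(\<exists>t\<in>{0..r}. 1 \<le> \<bar>f t\<bar>) \<longleftrightarrow>
    (\<forall>m::nat. \<exists>N::nat. \<exists>j\<le>2 ^ N. 1 - 1 / real (Suc m) < \<bar>f (real j * r / 2 ^ N)\<bar>)"
proof
  assume "\<exists>t\<in>{0..r}. 1 \<le> \<bar>f t\<bar>"
  then obtain t where t: "0 \<le> t" "t \<le> r" "1 \<le> \<bar>f t\<bar>" by auto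
  show "\<forall>m::nat. \<exists>N::nat. \<exists>j\<le>2 ^ N. 1 - 1 / real (Suc m) < \<bar>f (real j * r / 2 ^ N)\<bar>"
  proof
    fix m :: nat
    define e where "e = 1 / real (Suc m)"
    have e: "0 < e" by (simp add: e_def)
    from cont t have "continuous (at t within {0..r}) f"
      by (simp add: continuous_on_eq_continuous_within)
    then obtain d where d: "0 < d" "\<And>s. s \<in> {0..r} \<Longrightarrow> dist s t < d \<Longrightarrow> dist (f s) (f t) < e"
      using e unfolding continuous_within_eps_delta by blast
    obtain N :: nat where N: "r / d < 2 ^ N"
      using real_arch_pow[of 2 "r / d"] by auto
    define j where "j = (if r = 0 then 0 else nat \<lfloor>t / r * 2 ^ N\<rfloor>)"
    have j: "real j * r / 2 ^ N \<le> t \<and> t < real j * r / 2 ^ N + d \<and> j \<le> 2 ^ N"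
    proof (cases "r = 0")
      case True
      then show ?thesis using t d by (simp add: j_def)
    next
      case False
      with r have r0: "0 < r" by simp
      have "0 \<le> t / r * 2 ^ N" using t r0 by simp
      then have fl: "real j \<le> t / r * 2 ^ N" "t / r * 2 ^ N < real j + 1"
        using False by (simp_all add: j_def)
      have "t / r * 2 ^ N \<le> 1 * 2 ^ N"
        using t r0 by (intro mult_right_mono) auto
      then have "real j \<le> 2 ^ N" using fl(1) by linarith
      then have "j \<le> 2 ^ N" by (metis of_nat_le_iff of_nat_numeral of_nat_power)
      moreover have "real j * r / 2 ^ N \<le> t" using fl(1) r0 by (simp add: field_simps)
      moreover have "t < real j * r / 2 ^ N + r / 2 ^ N" using fl(2) r0 by (simp add: field_simps)
      moreover have "r / 2 ^ N < d" using N d by (simp add: field_simps)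
      ultimately show ?thesis by linarith
    qed
    define s where "s = real j * r / 2 ^ N"
    have "s \<in> {0..r}" "dist s t < d"
      using j t r by (auto simp: s_def dist_real_def)
    then have "dist (f s) (f t) < e" by (rule d)
    then have "1 - e < \<bar>f s\<bar>" using t by (simp add: dist_real_def)
    then show "\<exists>N::nat. \<exists>j\<le>2 ^ N. 1 - 1 / real (Suc m) < \<bar>f (real j * r / 2 ^ N)\<bar>"
      using j unfolding s_def e_def by blast
  qed
next
  assume *: "\<forall>m::nat. \<exists>N::nat. \<exists>j\<le>2 ^ N. 1 - 1 / real (Suc m) < \<bar>f (real j * r / 2 ^ N)\<bar>"
  have "\<exists>x\<in>{0..r}. \<forall>y\<in>{0..r}. \<bar>f y\<bar> \<le> \<bar>f x\<bar>"
    using cont r by (intro continuous_attains_sup continuous_intros) auto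
  then obtain x where x: "x \<in> {0..r}" "\<And>y. y \<in> {0..r} \<Longrightarrow> \<bar>f y\<bar> \<le> \<bar>f x\<bar>" by blast
  have "1 \<le> \<bar>f x\<bar>"
  proof (rule ccontr)
    assume "\<not> 1 \<le> \<bar>f x\<bar>"
    then obtain m where m: "1 / real (Suc m) < 1 - \<bar>f x\<bar>"
      using nat_approx_posE[of "1 - \<bar>f x\<bar>"] by auto
    obtain N j where j: "j \<le> (2::nat) ^ N" "1 - 1 / real (Suc m) < \<bar>f (real j * r / 2 ^ N)\<bar>"
      using * by blast
    have "real j \<le> 2 ^ N" using j(1) by (metis of_nat_le_iff of_nat_numeral of_nat_power)
    then have "real j * r / 2 ^ N \<in> {0..r}"
      using r by (auto simp: field_simps intro: mult_left_mono)
    from x(2)[OF this] j(2) m show False by linarith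
  qed
  with x show "\<exists>t\<in>{0..r}. 1 \<le> \<bar>f t\<bar>" by blast
qed

definition hit_time :: "(real \<Rightarrow> real) \<Rightarrow> ennreal" where
  "hit_time f = (INF t\<in>{t. 0 \<le> t \<and> 1 \<le> \<bar>f t\<bar>}. ennreal t)"

text \<open>The infimum is attained because the set of hitting times is closed.\<close>
lemma hit_time_attained:
  fixes f :: "real \<Rightarrow> real"
  assumes cont: "continuous_on {0..} f" and fin: "hit_time f < \<infinity>"
  obtains t where "0 \<le> t" "hit_time f = ennreal t" "1 \<le> \<bar>f t\<bar>"
    "\<And>s. 0 \<le> s \<Longrightarrow> s < t \<Longrightarrow> \<bar>f s\<bar> < 1"
proof -
  define H where "H = {t \<in> {0..}. 1 \<le> \<bar>f t\<bar>}"
  have H: "{t. 0 \<le> t \<and> 1 \<le> \<bar>f t\<bar>} = H" by (auto simp: H_def)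
  have ne: "H \<noteq> {}"
    using fin unfolding hit_time_def H by auto
  have cl: "closed H"
    unfolding H_def using continuous_closed_preimage[of "{0..}" "\<lambda>t. \<bar>f t\<bar>" "{1..}"] cont
    by (auto simp: vimage_def Int_def intro!: continuous_intros)
  have bdd: "bdd_below H" by (auto simp: H_def)
  define t where "t = Inf H"
  have t: "t \<in> H" unfolding t_def by (rule closed_contains_Inf[OF ne bdd cl])
  have le: "t \<le> s" if "s \<in> H" for s unfolding t_def by (rule cInf_lower[OF that bdd])
  have "hit_time f = ennreal t"
    unfolding hit_time_def H
    by (intro antisym INF_lower t INF_greatest ennreal_leI le)
  then show ?thesis
    using t le by (intro that[of t]) (auto simp: H_def not_le[symmetric])
qed

lemma hit_time_le_iff:
  fixes f :: "real \<Rightarrow> real"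
  assumes cont: "continuous_on {0..} f" and r: "0 \<le> r"
  shows "hit_time f \<le> ennreal r \<longleftrightarrow> (\<exists>t\<in>{0..r}. 1 \<le> \<bar>f t\<bar>)"
proof
  assume *: "hit_time f \<le> ennreal r"
  then have "hit_time f < \<infinity>" using le_less_trans by fastforce
  from hit_time_attained[OF cont this] obtain t where
    "0 \<le> t" "hit_time f = ennreal t" "1 \<le> \<bar>f t\<bar>" by metis
  with * r show "\<exists>t\<in>{0..r}. 1 \<le> \<bar>f t\<bar>" by (auto intro!: bexI[of _ t])
next
  assume "\<exists>t\<in>{0..r}. 1 \<le> \<bar>f t\<bar>"
  then obtain t where "t \<in> {0..r}" "1 \<le> \<bar>f t\<bar>" by blast
  then show "hit_time f \<le> ennreal r"
    unfolding hit_time_def by (intro INF_lower2[of t]) (auto intro: ennreal_leI)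
qed

section \<open>Gaussian increments and survival up to a fixed time\<close>

text \<open>Completing the square turns the exponential weight into a shift of the normal density.\<close>
lemma distributed_normal_exp:
  assumes D: "distributed M lborel Z (normal_density 0 s)" and s: "0 < s"
  shows "integrable M (\<lambda>\<omega>. exp (l * Z \<omega>))" (is ?int)
    and "(\<integral>\<omega>. exp (l * Z \<omega>) \<partial>M) = exp (l\<^sup>2 * s\<^sup>2 / 2)" (is ?eq)
proof -
  have shift: "normal_density 0 s x * exp (l * x) = exp (l\<^sup>2 * s\<^sup>2 / 2) * normal_density (l * s\<^sup>2) s x" for x
  proof -
    have "exp (- (x\<^sup>2) / (2 * s\<^sup>2)) * exp (l * x) =
      exp (l\<^sup>2 * s\<^sup>2 / 2) * exp (- (x - l * s\<^sup>2)\<^sup>2 / (2 * s\<^sup>2))"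
      unfolding exp_add[symmetric] using s
      by (intro arg_cong[where f = exp]) (simp add: field_simps power2_eq_square)
    then show ?thesis by (simp add: normal_density_def field_simps)
  qed
  have nn: "0 \<le> normal_density 0 s x" for x by simp
  have "integrable lborel (\<lambda>x. normal_density 0 s x * exp (l * x))"
    unfolding shift using s by simp
  then show ?int
    using distributed_integrable[OF D, of "\<lambda>x. exp (l * x)"] nn by simp
  have "(\<integral>\<omega>. exp (l * Z \<omega>) \<partial>M) = (\<integral>x. normal_density 0 s x * exp (l * x) \<partial>lborel)"
    using distributed_integral[OF D, of "\<lambda>x. exp (l * x)"] nn by simp
  also have "\<dots> = exp (l\<^sup>2 * s\<^sup>2 / 2)"
    unfolding shift using s by simp
  finally show ?eq .
qed

lemma distributed_normal_char:
  assumes M: "prob_space M" and D: "distributed M lborel Z (normal_density 0 s)" and s: "0 < s"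
  shows "(\<integral>\<omega>. exp (\<i> * of_real (b * Z \<omega>)) \<partial>M) = of_real (exp (- (b\<^sup>2 * s\<^sup>2 / 2)))"
proof -
  interpret prob_space M by fact
  have D': "distributed M lborel (\<lambda>\<omega>. (Z \<omega> - 0) / s) std_normal_density"
    using D normal_standard_normal_convert[OF s, where X = Z and \<mu> = 0] by blast
  have mZ[measurable]: "Z \<in> borel_measurable M" using D by (auto simp: distributed_def)
  have "(\<integral>\<omega>. exp (\<i> * of_real (b * Z \<omega>)) \<partial>M) = (\<integral>x. exp (\<i> * of_real (b * s * x)) \<partial>distr M lborel (\<lambda>\<omega>. (Z \<omega> - 0) / s))"
    using s by (subst integral_distr) auto
  also have "\<dots> = char std_normal_distribution (b * s)"
    unfolding char_def distributed_distr_eq_density[OF D'] by simp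
  finally show ?thesis by (simp add: char_std_normal_distribution power_mult_distrib)
qed

context linear_brownian_motion
begin

definition alive :: "real \<Rightarrow> 'a \<Rightarrow> bool" where
  "alive r \<omega> \<longleftrightarrow> (\<forall>s\<in>{0..r}. \<bar>X s \<omega>\<bar> < 1)"

lemma alive_iff:
  assumes "\<omega> \<in> space M" "0 \<le> r"
  shows "alive r \<omega> \<longleftrightarrow>
    (\<exists>m. \<forall>N. \<forall>j\<le>2 ^ N. \<bar>X (real j * r / 2 ^ N) \<omega>\<bar> \<le> 1 - 1 / real (Suc m))"
proof -
  have "continuous_on {0..r} (\<lambda>t. X t \<omega>)"
    using continuous_paths[OF assms(1)] by (rule continuous_on_subset) auto
  from dyadic_hit_iff[OF this assms(2)] show ?thesis
    unfolding alive_def by (meson not_le)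
qed

lemma X_measurable[measurable]: "0 \<le> t \<Longrightarrow> X t \<in> borel_measurable M"
  by (rule random_variable_X)

lemma alive_pred[measurable]: "0 \<le> r \<Longrightarrow> Measurable.pred M (alive r)"
proof -
  assume r: "0 \<le> r"
  have [measurable]: "X (real j * r / 2 ^ N) \<in> borel_measurable M" for j N
    using r by (intro random_variable_X) auto
  have "Measurable.pred M (\<lambda>\<omega>.
    (\<exists>m. \<forall>N. \<forall>j\<in>{..(2::nat) ^ N}. \<bar>X (real j * r / 2 ^ N) \<omega>\<bar> \<le> 1 - 1 / real (Suc m)))"
    by measurable
  then show ?thesis
    by (subst measurable_cong[OF alive_iff[OF _ r]]) (simp_all add: Ball_def)
qed

lemma exp_increment:
  assumes "0 \<le> r" "r \<le> t"
  shows "integrable M (\<lambda>\<omega>. exp (l * (X t \<omega> - X r \<omega>)))" (is ?int)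
    and "expectation (\<lambda>\<omega>. exp (l * (X t \<omega> - X r \<omega>))) = exp (l\<^sup>2 * (t - r) / 2)" (is ?eq)
proof -
  have "?int \<and> ?eq"
  proof (cases "r = t")
    case True
    then show ?thesis by (simp add: prob_space)
  next
    case False
    with assms have "r < t" by simp
    from distributed_normal_exp[OF gaussian_increments[OF assms(1) this], of l] this
    show ?thesis by simp
  qed
  then show ?int ?eq by auto
qed

lemma exp_X:
  assumes "0 \<le> t"
  shows "integrable M (\<lambda>\<omega>. exp (l * X t \<omega>))" (is ?int)
    and "expectation (\<lambda>\<omega>. exp (l * X t \<omega>)) = exp (l * x + l\<^sup>2 * t / 2)" (is ?eq)
proof -
  have AE: "AE \<omega> in M. exp (l * X t \<omega>) = exp (l * x) * exp (l * (X t \<omega> - X 0 \<omega>))"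
    using start by eventually_elim (simp add: exp_add[symmetric] algebra_simps)
  have [measurable]: "X t \<in> borel_measurable M" "X 0 \<in> borel_measurable M"
    using assms by auto
  show ?int
    by (subst integrable_cong_AE[OF _ _ AE])
      (use exp_increment[OF order.refl assms, of l] in auto)
  show ?eq
    by (subst integral_cong_AE[OF _ _ AE])
      (use exp_increment[OF order.refl assms, of l] in \<open>auto simp: exp_add\<close>)
qed

text \<open>Up to the almost sure starting value, \<open>G\<close> and \<open>X r\<close> are functions of the increments along the grid,
  and these are independent of the increment from \<open>r\<close> to \<open>t\<close>.\<close>
lemma grid_markov:
  fixes N :: nat and c :: real
  assumes r: "0 \<le> r" "r \<le> t"
  defines "G \<equiv> \<lambda>\<omega>. \<forall>j\<le>(2::nat) ^ N. \<bar>X (real j * r / 2 ^ N) \<omega>\<bar> \<le> c"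
  shows "expectation (\<lambda>\<omega>. of_bool (G \<omega>) * exp (l * X t \<omega>)) =
    exp (l\<^sup>2 * (t - r) / 2) * expectation (\<lambda>\<omega>. of_bool (G \<omega>) * exp (l * X r \<omega>))"
proof -
  define K :: nat where "K = 2 ^ N"
  define s where "s i = (if i \<le> K then real i * r / 2 ^ N else t)" for i
  have K: "real K = 2 ^ N" by (simp add: K_def)
  have s_le: "s i \<le> r" if "i \<le> K" for i
  proof -
    have "real i * r \<le> 2 ^ N * r"
      using that r(1) K by (intro mult_right_mono) (metis of_nat_le_iff, simp)
    then show ?thesis using that by (simp add: s_def field_simps)
  qed
  have sK: "s K = r" "s (Suc K) = t" by (simp_all add: s_def K)
  have s0: "s 0 = 0" by (simp add: s_def)
  have s_nonneg: "0 \<le> s i" for i using r by (simp add: s_def)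
  have "mono s"
  proof (rule monoI)
    fix i j :: nat assume "i \<le> j"
    then show "s i \<le> s j"
      using s_le[of i] r by (auto simp: s_def intro!: divide_right_mono mult_right_mono)
  qed
  define D where "D i \<omega> = X (s (Suc i)) \<omega> - X (s i) \<omega>" for i \<omega>
  have "indep_vars (\<lambda>_. borel) D {..<Suc K}"
    using indep_increments[OF \<open>mono s\<close>, of "Suc K"] s0 unfolding D_def by simp
  then have ind: "indep_var (PiM {..<K} (\<lambda>_. borel)) (\<lambda>\<omega>. restrict (\<lambda>i. D i \<omega>) {..<K})
      (PiM {K} (\<lambda>_. borel)) (\<lambda>\<omega>. restrict (\<lambda>i. D i \<omega>) {K})"
    by (rule indep_var_restrict) auto
  define P where "P v j = x + (\<Sum>i<j. v i)" for v :: "nat \<Rightarrow> real" and j :: nat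
  define F where "F v = of_bool (\<forall>j\<in>{..K}. \<bar>P v j\<bar> \<le> c) * exp (l * P v K)" for v
  have [measurable]: "(\<lambda>v. P v j) \<in> borel_measurable (PiM {..<K} (\<lambda>_. borel))" if "j \<le> K" for j
    unfolding P_def using that
    by (intro borel_measurable_add borel_measurable_const borel_measurable_sum
        measurable_component_singleton) auto
  have F[measurable]: "F \<in> borel_measurable (PiM {..<K} (\<lambda>_. borel))"
    unfolding F_def by measurable
  define E where "E v = exp (l * v K)" for v :: "nat \<Rightarrow> real"
  have E: "E \<in> borel_measurable (PiM {K} (\<lambda>_. borel))"
    unfolding E_def by measurable
  from indep_var_compose[OF ind F E]
  have ind': "indep_var borel (\<lambda>\<omega>. F (restrict (\<lambda>i. D i \<omega>) {..<K})) borel (\<lambda>\<omega>. exp (l * (X t \<omega> - X r \<omega>)))"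
    by (simp add: comp_def E_def D_def sK)
  have P: "P (restrict (\<lambda>i. D i \<omega>) {..<K}) j = X (s j) \<omega>" if "X 0 \<omega> = x" "j \<le> K" for \<omega> j
  proof -
    have "(\<Sum>i<j. restrict (\<lambda>i. D i \<omega>) {..<K} i) = (\<Sum>i<j. D i \<omega>)"
      using that by (intro sum.cong) auto
    also have "\<dots> = X (s j) \<omega> - X (s 0) \<omega>"
      unfolding D_def by (rule sum_lessThan_telescope)
    finally show ?thesis using that by (simp add: P_def s0)
  qed
  have Fr: "F (restrict (\<lambda>i. D i \<omega>) {..<K}) = of_bool (G \<omega>) * exp (l * X r \<omega>)"
    if "X 0 \<omega> = x" for \<omega>
  proof -
    have "(\<forall>j\<in>{..K}. \<bar>P (restrict (\<lambda>i. D i \<omega>) {..<K}) j\<bar> \<le> c) \<longleftrightarrow> G \<omega>"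
      unfolding G_def K_def[symmetric] using P[OF that] by (simp add: s_def Ball_def)
    then show ?thesis using P[OF that, of K] by (simp add: F_def sK)
  qed
  have [measurable]: "X t \<in> borel_measurable M" "X r \<in> borel_measurable M"
    using r by auto
  have [measurable]: "X (real j * r / 2 ^ N) \<in> borel_measurable M" for j
    using r by (intro random_variable_X) auto
  have "Measurable.pred M (\<lambda>\<omega>. \<forall>j\<in>{..(2::nat) ^ N}. \<bar>X (real j * r / 2 ^ N) \<omega>\<bar> \<le> c)"
    by measurable
  then have [measurable]: "Measurable.pred M G" unfolding G_def by (simp add: Ball_def)
  have mF: "(\<lambda>\<omega>. F (restrict (\<lambda>i. D i \<omega>) {..<K})) \<in> borel_measurable M"
    using indep_var_rv1[OF ind'] .
  have AE1: "AE \<omega> in M. F (restrict (\<lambda>i. D i \<omega>) {..<K}) = of_bool (G \<omega>) * exp (l * X r \<omega>)"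
    using start by eventually_elim (rule Fr)
  have AE2: "AE \<omega> in M. of_bool (G \<omega>) * exp (l * X t \<omega>) =
      F (restrict (\<lambda>i. D i \<omega>) {..<K}) * exp (l * (X t \<omega> - X r \<omega>))"
    using AE1 by eventually_elim (simp add: exp_add[symmetric] algebra_simps)
  have iG: "integrable M (\<lambda>\<omega>. of_bool (G \<omega>) * exp (l * X r \<omega>))"
    by (rule Bochner_Integration.integrable_bound[OF exp_X(1)[OF r(1), of l]]) auto
  have iF: "integrable M (\<lambda>\<omega>. F (restrict (\<lambda>i. D i \<omega>) {..<K}))"
    by (subst integrable_cong_AE[OF mF _ AE1]) (use iG in auto)
  have "expectation (\<lambda>\<omega>. of_bool (G \<omega>) * exp (l * X t \<omega>)) =
      expectation (\<lambda>\<omega>. F (restrict (\<lambda>i. D i \<omega>) {..<K}) * exp (l * (X t \<omega> - X r \<omega>)))"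
    using mF by (intro integral_cong_AE AE2) auto
  also have "\<dots> = expectation (\<lambda>\<omega>. F (restrict (\<lambda>i. D i \<omega>) {..<K})) * exp (l\<^sup>2 * (t - r) / 2)"
    using indep_var_lebesgue_integral[OF ind' iF exp_increment(1)[OF r]]
      exp_increment(2)[OF r] by simp
  also have "expectation (\<lambda>\<omega>. F (restrict (\<lambda>i. D i \<omega>) {..<K})) =
      expectation (\<lambda>\<omega>. of_bool (G \<omega>) * exp (l * X r \<omega>))"
    using mF by (intro integral_cong_AE AE1) auto
  finally show ?thesis by simp
qed

text \<open>The grid events \<open>G m N\<close> decrease in \<open>N\<close>, because the grids are nested, and their limits \<open>H m\<close> increase
  to survival.\<close>
lemma alive_limit:
  assumes r: "0 \<le> r" and f: "integrable M (f :: 'a \<Rightarrow> real)"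
  defines "G \<equiv> \<lambda>m N \<omega>. \<forall>j\<le>(2::nat) ^ N. \<bar>X (real j * r / 2 ^ N) \<omega>\<bar> \<le> 1 - 1 / real (Suc m)"
  defines "H \<equiv> \<lambda>m \<omega>. \<forall>N. G m N \<omega>"
  shows "(\<lambda>N. expectation (\<lambda>\<omega>. of_bool (G m N \<omega>) * f \<omega>)) \<longlonglongrightarrow> expectation (\<lambda>\<omega>. of_bool (H m \<omega>) * f \<omega>)"
    and "(\<lambda>m. expectation (\<lambda>\<omega>. of_bool (H m \<omega>) * f \<omega>)) \<longlonglongrightarrow> expectation (\<lambda>\<omega>. of_bool (alive r \<omega>) * f \<omega>)"
proof -
  have [measurable]: "f \<in> borel_measurable M" using f by auto
  have [measurable]: "X (real j * r / 2 ^ N) \<in> borel_measurable M" for j N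
    using r by (intro random_variable_X) auto
  have "Measurable.pred M (\<lambda>\<omega>. \<forall>j\<in>{..(2::nat) ^ N}. \<bar>X (real j * r / 2 ^ N) \<omega>\<bar> \<le> 1 - 1 / real (Suc m))" for m N
    by measurable
  then have [measurable]: "Measurable.pred M (G m N)" for m N unfolding G_def by (simp add: Ball_def)
  have [measurable]: "Measurable.pred M (H m)" for m unfolding H_def by measurable
  have decG: "G m N \<omega>" if "G m N' \<omega>" "N \<le> N'" for m N N' \<omega>
    unfolding G_def
  proof (intro allI impI)
    fix j :: nat assume j: "j \<le> 2 ^ N"
    have pow: "(2::nat) ^ N' = 2 ^ N * 2 ^ (N' - N)" using that(2) by (simp flip: power_add)
    have powr: "(2::real) ^ N' = 2 ^ N * 2 ^ (N' - N)" using that(2) by (simp flip: power_add)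
    have "j * 2 ^ (N' - N) \<le> 2 ^ N'" using j pow by simp
    with that(1) have "\<bar>X (real (j * 2 ^ (N' - N)) * r / 2 ^ N') \<omega>\<bar> \<le> 1 - 1 / real (Suc m)"
      unfolding G_def by blast
    also have "real (j * 2 ^ (N' - N)) * r / 2 ^ N' = real j * r / 2 ^ N"
      by (simp add: powr)
    finally show "\<bar>X (real j * r / 2 ^ N) \<omega>\<bar> \<le> 1 - 1 / real (Suc m)" .
  qed
  have limG: "(\<lambda>N. of_bool (G m N \<omega>) :: real) \<longlonglongrightarrow> of_bool (H m \<omega>)" for m \<omega>
  proof (cases "H m \<omega>")
    case True
    then show ?thesis by (simp add: H_def)
  next
    case False
    then obtain N0 where "\<not> G m N0 \<omega>" by (auto simp: H_def)
    then have "\<not> G m N \<omega>" if "N \<ge> N0" for N using decG that by blast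
    then have "\<forall>\<^sub>F N in sequentially. of_bool (G m N \<omega>) = (of_bool (H m \<omega>) :: real)"
      using False by (auto intro: eventually_sequentiallyI)
    then show ?thesis by (rule tendsto_eventually)
  qed
  have incH: "H m' \<omega>" if "H m \<omega>" "m \<le> m'" for m m' \<omega>
  proof -
    have "1 / real (Suc m') \<le> 1 / real (Suc m)" using that(2) by (simp add: frac_le)
    then show ?thesis using that(1) unfolding H_def G_def by fastforce
  qed
  have limH: "(\<lambda>m. of_bool (H m \<omega>) :: real) \<longlonglongrightarrow> of_bool (alive r \<omega>)" if sp: "\<omega> \<in> space M" for \<omega>
  proof (cases "alive r \<omega>")
    case False
    then have "\<not> H m \<omega>" for m
      using alive_iff[OF sp r] unfolding H_def G_def by blast
    with False show ?thesis by simp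
  next
    case True
    then obtain m0 where "H m0 \<omega>" using alive_iff[OF sp r] by (auto simp: H_def G_def)
    then have "H m \<omega>" if "m \<ge> m0" for m using incH that by blast
    then have "\<forall>\<^sub>F m in sequentially. of_bool (H m \<omega>) = (of_bool (alive r \<omega>) :: real)"
      using True by (auto intro: eventually_sequentiallyI)
    then show ?thesis by (rule tendsto_eventually)
  qed
  have "AE \<omega> in M. (\<lambda>N. of_bool (G m N \<omega>) * f \<omega>) \<longlonglongrightarrow> of_bool (H m \<omega>) * f \<omega>"
    by (intro AE_I2 tendsto_mult limG tendsto_const)
  then show "(\<lambda>N. expectation (\<lambda>\<omega>. of_bool (G m N \<omega>) * f \<omega>)) \<longlonglongrightarrow> expectation (\<lambda>\<omega>. of_bool (H m \<omega>) * f \<omega>)"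
    by (intro integral_dominated_convergence[where w = "\<lambda>\<omega>. \<bar>f \<omega>\<bar>"])
      (use f in auto)
  have "AE \<omega> in M. (\<lambda>m. of_bool (H m \<omega>) * f \<omega>) \<longlonglongrightarrow> of_bool (alive r \<omega>) * f \<omega>"
    by (intro AE_I2 tendsto_mult limH tendsto_const)
  then show "(\<lambda>m. expectation (\<lambda>\<omega>. of_bool (H m \<omega>) * f \<omega>)) \<longlonglongrightarrow> expectation (\<lambda>\<omega>. of_bool (alive r \<omega>) * f \<omega>)"
    by (intro integral_dominated_convergence[where w = "\<lambda>\<omega>. \<bar>f \<omega>\<bar>"])
      (use f r in auto)
qed

text \<open>This is the martingale property of \<open>exp (l X\<^sub>t - l\<^sup>2 t / 2)\<close> on the one family of past events that
  stopping at the exit time requires.\<close>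
lemma alive_markov:
  assumes r: "0 \<le> r" "r \<le> t"
  shows "expectation (\<lambda>\<omega>. of_bool (alive r \<omega>) * exp (l * X t \<omega>)) =
    exp (l\<^sup>2 * (t - r) / 2) * expectation (\<lambda>\<omega>. of_bool (alive r \<omega>) * exp (l * X r \<omega>))"
proof -
  define G where "G m N \<omega> \<longleftrightarrow> (\<forall>j\<le>(2::nat) ^ N. \<bar>X (real j * r / 2 ^ N) \<omega>\<bar> \<le> 1 - 1 / real (Suc m))" for m N \<omega>
  define H where "H m \<omega> \<longleftrightarrow> (\<forall>N. G m N \<omega>)" for m \<omega>
  define C where "C = exp (l\<^sup>2 * (t - r) / 2)"
  have t: "0 \<le> t" using r by simp
  note lims = alive_limit[OF r(1), folded G_def, folded H_def]
  have G: "expectation (\<lambda>\<omega>. of_bool (G m N \<omega>) * exp (l * X t \<omega>)) =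
    C * expectation (\<lambda>\<omega>. of_bool (G m N \<omega>) * exp (l * X r \<omega>))" for m N
    unfolding G_def C_def by (rule grid_markov[OF r])
  have H: "expectation (\<lambda>\<omega>. of_bool (H m \<omega>) * exp (l * X t \<omega>)) =
    C * expectation (\<lambda>\<omega>. of_bool (H m \<omega>) * exp (l * X r \<omega>))" for m
    using lims(1)[OF exp_X(1)[OF t, of l], of m, unfolded G]
      tendsto_mult_left[OF lims(1)[OF exp_X(1)[OF r(1), of l], of m], of C]
    by (rule LIMSEQ_unique)
  show ?thesis
    using lims(2)[OF exp_X(1)[OF t, of l], unfolded H]
      tendsto_mult_left[OF lims(2)[OF exp_X(1)[OF r(1), of l]], of C]
    unfolding C_def by (rule LIMSEQ_unique)
qed

end

section \<open>Stopping at the exit time\<close>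

text \<open>Truncating at level \<open>R\<close> costs at most \<open>C / R\<close> in the mean, since \<open>v - v\<^sup>2 / R \<le> min v R \<le> v\<close>, and the
  truncated variables converge by dominated convergence. A bound in \<open>L\<^sup>2\<close> thus replaces a pointwise
  majorant, which is not at hand for the position of the path slightly after its exit.\<close>
lemma (in prob_space) expectation_limit_of_L2_bounded:
  fixes V :: "nat \<Rightarrow> 'a \<Rightarrow> real"
  assumes V: "\<And>n. integrable M (\<lambda>\<omega>. (V n \<omega>)\<^sup>2)" "\<And>n. integrable M (V n)"
    and nonneg: "\<And>n \<omega>. 0 \<le> V n \<omega>"
    and mean: "\<And>n. expectation (V n) = c"
    and L2: "\<And>n. expectation (\<lambda>\<omega>. (V n \<omega>)\<^sup>2) \<le> C"
    and lim: "AE \<omega> in M. (\<lambda>n. V n \<omega>) \<longlonglongrightarrow> W \<omega>"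
    and W[measurable]: "W \<in> borel_measurable M" and bdd: "AE \<omega> in M. W \<omega> \<le> b"
  shows "expectation W = c"
proof -
  have [measurable]: "V n \<in> borel_measurable M" for n using V(2) by auto
  have C: "0 \<le> C" using L2[of 0] by (rule order_trans[rotated]) (simp add: integral_nonneg)
  have step: "c - C / R \<le> expectation W \<and> expectation W \<le> c" if R: "0 < R" "b \<le> R" for R
  proof -
    have "(\<lambda>n. expectation (\<lambda>\<omega>. min (V n \<omega>) R)) \<longlonglongrightarrow> expectation W"
    proof (rule integral_dominated_convergence[where w = "\<lambda>_. R"])
      show "AE \<omega> in M. (\<lambda>n. min (V n \<omega>) R) \<longlonglongrightarrow> W \<omega>"
        using lim bdd
      proof eventually_elim
        case (elim \<omega>)
        have "(\<lambda>n. min (V n \<omega>) R) \<longlonglongrightarrow> min (W \<omega>) R"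
          by (intro tendsto_min elim tendsto_const)
        with elim R show ?case by (simp add: min_absorb1)
      qed
      show "AE \<omega> in M. norm (min (V n \<omega>) R) \<le> R" for n
        using nonneg[of n] R by (auto simp: min_def)
    qed auto
    moreover have "expectation (\<lambda>\<omega>. min (V n \<omega>) R) \<le> c" for n
      unfolding mean[of n, symmetric] using V(2)[of n]
      by (intro integral_mono) auto
    moreover have "c - C / R \<le> expectation (\<lambda>\<omega>. min (V n \<omega>) R)" for n
    proof -
      have "c - C / R \<le> expectation (V n) - expectation (\<lambda>\<omega>. (V n \<omega>)\<^sup>2) / R"
        using L2[of n] R by (simp add: mean divide_right_mono)
      also have "\<dots> = expectation (\<lambda>\<omega>. V n \<omega> - (V n \<omega>)\<^sup>2 / R)"
        using V[of n] by simp
      also have "\<dots> \<le> expectation (\<lambda>\<omega>. min (V n \<omega>) R)"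
      proof (rule integral_mono)
        fix \<omega>
        have "V n \<omega> - (V n \<omega>)\<^sup>2 / R \<le> R"
        proof (cases "V n \<omega> \<le> R")
          case True
          have "0 \<le> (V n \<omega>)\<^sup>2 / R" using R by simp
          with True show ?thesis by linarith
        next
          case False
          then have "V n \<omega> \<le> (V n \<omega>)\<^sup>2 / R"
            using R nonneg[of n \<omega>] by (simp add: field_simps power2_eq_square mult_left_mono)
          with R show ?thesis by linarith
        qed
        moreover have "0 \<le> (V n \<omega>)\<^sup>2 / R" using R by simp
        ultimately show "V n \<omega> - (V n \<omega>)\<^sup>2 / R \<le> min (V n \<omega>) R" by simp
      qed (use V[of n] in auto)
      finally show ?thesis .
    qed
    ultimately show ?thesis
      by (auto intro: LIMSEQ_le_const LIMSEQ_le_const2)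
  qed
  have "expectation W \<le> c" using step[of "max 1 b"] by auto
  moreover have "c \<le> expectation W"
  proof (rule tendsto_upperbound)
    show "((\<lambda>R. c - C / R) \<longlongrightarrow> c) at_top"
      by (rule tendsto_eq_intros tendsto_divide_0[OF tendsto_const] filterlim_ident
          filterlim_at_top_imp_at_infinity refl | simp)+
    show "\<forall>\<^sub>F R in at_top. c - C / R \<le> expectation W"
      using eventually_ge_at_top[of "max 1 b"] by eventually_elim (use step in auto)
  qed simp
  ultimately show ?thesis by simp
qed

lemma stopped_Suc:
  fixes f :: "nat \<Rightarrow> 'b::ring_1"
  shows "f (min (Suc k) n) = f (min k n) + of_bool (k < n) * (f (Suc k) - f k)"
  by (cases "k < n") (auto simp: min_def)

lemma dyadic_ceiling:
  fixes T :: real and K :: nat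
  assumes "0 \<le> T"
  defines "\<kappa> \<equiv> \<lambda>n. nat \<lceil>T * 2 ^ n\<rceil>"
  shows "(\<lambda>n. real (\<kappa> n) / 2 ^ n) \<longlonglongrightarrow> T"
    and "(\<lambda>n. real (min (K * 2 ^ n) (\<kappa> n)) / 2 ^ n) \<longlonglongrightarrow> min (real K) T"
    and "(\<lambda>n. real (min (n * 2 ^ n) (\<kappa> n)) / 2 ^ n) \<longlonglongrightarrow> T"
proof -
  have \<kappa>: "T \<le> real (\<kappa> n) / 2 ^ n" "real (\<kappa> n) / 2 ^ n \<le> T + (1 / 2) ^ n" for n
  proof -
    have "0 \<le> T * 2 ^ n" using assms(1) by simp
    then have "T * 2 ^ n \<le> real (\<kappa> n)" "real (\<kappa> n) \<le> T * 2 ^ n + 1"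
      unfolding \<kappa>_def by linarith+
    then show "T \<le> real (\<kappa> n) / 2 ^ n" "real (\<kappa> n) / 2 ^ n \<le> T + (1 / 2) ^ n"
      by (simp_all add: field_simps)
  qed
  have "(\<lambda>n. T + (1 / 2) ^ n) \<longlonglongrightarrow> T + 0" (is "?u \<longlonglongrightarrow> _")
    by (rule tendsto_add[OF tendsto_const LIMSEQ_realpow_zero]) auto
  then have "?u \<longlonglongrightarrow> T" by simp
  then show lim: "(\<lambda>n. real (\<kappa> n) / 2 ^ n) \<longlonglongrightarrow> T"
    by (rule tendsto_sandwich[OF always_eventually always_eventually tendsto_const, rotated 2])
      (use \<kappa> in blast)+
  have eq: "real (min (j * 2 ^ n) (\<kappa> n)) / 2 ^ n = min (real j) (real (\<kappa> n) / 2 ^ n)" for j n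
    by (simp add: of_nat_min min_divide_distrib_right)
  show "(\<lambda>n. real (min (K * 2 ^ n) (\<kappa> n)) / 2 ^ n) \<longlonglongrightarrow> min (real K) T"
    unfolding eq by (rule tendsto_min[OF tendsto_const lim])
  have "\<forall>\<^sub>F n in sequentially. real (\<kappa> n) / 2 ^ n = min (real n) (real (\<kappa> n) / 2 ^ n)"
  proof -
    have "\<forall>\<^sub>F n in sequentially. real n \<ge> T + 1"
      by (meson eventually_sequentiallyI nat_ceiling_le_eq)
    then show ?thesis
    proof eventually_elim
      case (elim n)
      have "(1 / 2 :: real) ^ n \<le> 1" by (simp add: power_le_one)
      then show ?case using \<kappa>(2)[of n] elim by simp
    qed
  qed
  then show "(\<lambda>n. real (min (n * 2 ^ n) (\<kappa> n)) / 2 ^ n) \<longlonglongrightarrow> T"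
    unfolding eq by (rule Lim_transform_eventually[OF lim])
qed

lemma tendsto_at_nonneg:
  fixes f :: "real \<Rightarrow> 'b::topological_space"
  assumes "continuous_on {0..} f" "s \<longlonglongrightarrow> T" "\<And>n. 0 \<le> s n" "0 \<le> T"
  shows "(\<lambda>n. f (s n)) \<longlonglongrightarrow> f T"
  using assms by (intro continuous_on_tendsto_compose[OF assms(1) assms(2)]) auto

context linear_brownian_motion
begin

abbreviation T :: "'a \<Rightarrow> ennreal" where "T \<omega> \<equiv> hit_time (\<lambda>t. X t \<omega>)"

definition \<tau> :: "'a \<Rightarrow> real" where "\<tau> \<omega> = enn2real (T \<omega>)"

lemma \<tau>_nonneg[simp]: "0 \<le> \<tau> \<omega>" by (simp add: \<tau>_def)

lemma T_gt_iff_alive: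
  assumes "\<omega> \<in> space M" "0 \<le> r"
  shows "ennreal r < T \<omega> \<longleftrightarrow> alive r \<omega>"
  using hit_time_le_iff[OF continuous_paths[OF assms(1)] assms(2)] unfolding alive_def
  by (meson not_le)

lemma T_measurable[measurable]: "T \<in> borel_measurable M"
proof (rule borel_measurableI_greater)
  fix y :: ennreal
  show "{\<omega> \<in> space M. y < T \<omega>} \<in> sets M"
  proof (cases y)
    case (real r)
    then have [measurable]: "Measurable.pred M (alive r)" by simp
    have "{\<omega> \<in> space M. y < T \<omega>} = {\<omega> \<in> space M. alive r \<omega>}"
      using T_gt_iff_alive real by auto
    then show ?thesis by simp
  qed simp
qed

lemma \<tau>_measurable[measurable]: "\<tau> \<in> borel_measurable M"
  unfolding \<tau>_def[abs_def] by measurable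

text \<open>Survival up to time \<open>r\<close> confines a normal variable of variance \<open>r\<close> to an interval of length 2, and the
  density of that variable is at most \<open>1 / sqrt (2 pi r)\<close>.\<close>
lemma T_finite: "AE \<omega> in M. T \<omega> < \<infinity>"
proof -
  have bound: "prob {\<omega> \<in> space M. T \<omega> = \<infinity>} \<le> 2 / sqrt (2 * pi * real (Suc n))" for n
  proof -
    define r where "r = real (Suc n)"
    have r: "0 < r" by (simp add: r_def)
    have [measurable]: "X r \<in> borel_measurable M" "X 0 \<in> borel_measurable M" using r by auto
    have D: "distributed M lborel (\<lambda>\<omega>. X r \<omega> - X 0 \<omega>) (normal_density 0 (sqrt (r - 0)))"
      by (rule gaussian_increments) (use r in auto)
    have "prob {\<omega> \<in> space M. T \<omega> = \<infinity>} \<le> prob {\<omega> \<in> space M. X r \<omega> - X 0 \<omega> \<in> {-1 - x..1 - x}}"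
    proof (rule finite_measure_mono_AE)
      show "AE \<omega> in M. \<omega> \<in> {\<omega> \<in> space M. T \<omega> = \<infinity>} \<longrightarrow>
          \<omega> \<in> {\<omega> \<in> space M. X r \<omega> - X 0 \<omega> \<in> {-1 - x..1 - x}}"
        using start
      proof eventually_elim
        case (elim \<omega>)
        show ?case
        proof
          assume *: "\<omega> \<in> {\<omega> \<in> space M. T \<omega> = \<infinity>}"
          then have "alive r \<omega>" using T_gt_iff_alive[of \<omega> r] r by simp
          then have "\<bar>X r \<omega>\<bar> < 1" using r by (simp add: alive_def)
          then show "\<omega> \<in> {\<omega> \<in> space M. X r \<omega> - X 0 \<omega> \<in> {-1 - x..1 - x}}"
            using * elim by auto
        qed
      qed
    qed measurable
    also have "\<dots> \<le> 2 / sqrt (2 * pi * r)"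
    proof -
      have "emeasure M {\<omega> \<in> space M. X r \<omega> - X 0 \<omega> \<in> {-1 - x..1 - x}} =
          (\<integral>\<^sup>+y. ennreal (normal_density 0 (sqrt r) y) * indicator {-1 - x..1 - x} y \<partial>lborel)"
        using distributed_emeasure[OF D, of "{-1 - x..1 - x}"]
        by (simp add: vimage_def Int_def conj_commute)
      also have "\<dots> \<le> (\<integral>\<^sup>+y. ennreal (1 / sqrt (2 * pi * r)) * indicator {-1 - x..1 - x} y \<partial>lborel)"
      proof (intro nn_integral_mono mult_right_mono ennreal_leI)
        fix y
        have "exp (- y\<^sup>2 / (2 * r)) \<le> 1" using r by simp
        then show "normal_density 0 (sqrt r) y \<le> 1 / sqrt (2 * pi * r)"
          using r by (simp add: normal_density_def divide_right_mono)
      qed simp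
      also have "\<dots> = ennreal (1 / sqrt (2 * pi * r)) * emeasure lborel {-1 - x..1 - x}"
        by (rule nn_integral_cmult_indicator) simp
      also have "emeasure lborel {-1 - x..1 - x} = ennreal 2" by simp
      also have "ennreal (1 / sqrt (2 * pi * r)) * ennreal 2 = ennreal (2 / sqrt (2 * pi * r))"
        using r by (subst ennreal_mult[symmetric]) auto
      finally show ?thesis
        using r by (simp add: emeasure_eq_measure)
    qed
    finally show ?thesis by (simp add: r_def)
  qed
  have "(\<lambda>n. 2 / sqrt (2 * pi * real (Suc n))) \<longlonglongrightarrow> 0"
    by real_asymp
  then have "prob {\<omega> \<in> space M. T \<omega> = \<infinity>} \<le> 0"
    by (rule LIMSEQ_le_const) (use bound in auto)
  then have "prob {\<omega> \<in> space M. T \<omega> = \<infinity>} = 0"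
    using measure_nonneg[of M "{\<omega> \<in> space M. T \<omega> = \<infinity>}"] by linarith
  then have "AE \<omega> in M. \<omega> \<notin> {\<omega> \<in> space M. T \<omega> = \<infinity>}"
    by (subst (asm) prob_eq_0) auto
  then show ?thesis
    by (rule AE_mp) (auto intro!: AE_I2 simp: less_top)
qed

text \<open>The exit time rounded up to the grid \<open>k / 2 ^ n\<close>, as an index. Rounding up rather than down makes
  \<open>k < \<kappa> n\<close> an event of survival up to the grid point \<open>k\<close>.\<close>
definition \<kappa> :: "nat \<Rightarrow> 'a \<Rightarrow> nat" where "\<kappa> n \<omega> = nat \<lceil>\<tau> \<omega> * 2 ^ n\<rceil>"

lemma \<kappa>_measurable[measurable]: "\<kappa> n \<in> measurable M (count_space UNIV)"
  unfolding \<kappa>_def[abs_def] by measurable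

lemma less_\<kappa>_iff_alive:
  assumes "\<omega> \<in> space M" "T \<omega> < \<infinity>"
  shows "k < \<kappa> n \<omega> \<longleftrightarrow> alive (real k / 2 ^ n) \<omega>"
proof -
  have "k < \<kappa> n \<omega> \<longleftrightarrow> real k < \<tau> \<omega> * 2 ^ n"
    unfolding \<kappa>_def by linarith
  also have "\<dots> \<longleftrightarrow> real k / 2 ^ n < \<tau> \<omega>" by (simp add: field_simps)
  also have "\<dots> \<longleftrightarrow> ennreal (real k / 2 ^ n) < T \<omega>"
    using assms(2) unfolding \<tau>_def by (cases "T \<omega>") (auto simp: ennreal_less_iff)
  finally show ?thesis using T_gt_iff_alive[OF assms(1)] by simp
qed

lemma stopped_Suc_alive:
  fixes f :: "nat \<Rightarrow> 'a \<Rightarrow> 'b::ring_1"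
  shows "AE \<omega> in M. f (min (Suc k) (\<kappa> n \<omega>)) \<omega> =
    f (min k (\<kappa> n \<omega>)) \<omega> + of_bool (alive (real k / 2 ^ n) \<omega>) * (f (Suc k) \<omega> - f k \<omega>)"
  using T_finite AE_space
proof eventually_elim
  case (elim \<omega>)
  then show ?case
    using less_\<kappa>_iff_alive stopped_Suc[of "\<lambda>k. f k \<omega>" k "\<kappa> n \<omega>"] by simp
qed

lemma stopped_measurable:
  assumes "\<And>k. f k \<in> borel_measurable M"
  shows "(\<lambda>\<omega>. f (min k (\<kappa> n \<omega>)) \<omega>) \<in> borel_measurable M"
  by (rule measurable_compose_countable[where f = "\<lambda>i \<omega>. f i \<omega>" and g = "\<lambda>\<omega>. min k (\<kappa> n \<omega>)"])
    (use assms in measurable)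

text \<open>Summing the increments of the stopped sequence: step \<open>j\<close> is made exactly on the event of survival up to
  time \<open>j / 2 ^ n\<close>. Only expectations of the unstopped sequence on such events remain.\<close>
lemma stopped_expectation:
  fixes f :: "nat \<Rightarrow> 'a \<Rightarrow> 'b::{real_normed_field, banach, second_countable_topology}"
  assumes f: "\<And>k. integrable M (f k)"
  shows "integrable M (\<lambda>\<omega>. f (min k (\<kappa> n \<omega>)) \<omega>)"
    and "expectation (\<lambda>\<omega>. f (min k (\<kappa> n \<omega>)) \<omega>) = expectation (f 0) +
      (\<Sum>j<k. expectation (\<lambda>\<omega>. of_bool (alive (real j / 2 ^ n) \<omega>) * f (Suc j) \<omega>)
            - expectation (\<lambda>\<omega>. of_bool (alive (real j / 2 ^ n) \<omega>) * f j \<omega>))" (is "?L k = ?R k")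
proof -
  have m: "(\<lambda>\<omega>. f (min k (\<kappa> n \<omega>)) \<omega>) \<in> borel_measurable M" for k
    by (rule stopped_measurable) (use f in auto)
  have i: "integrable M (\<lambda>\<omega>. of_bool (alive (real j / 2 ^ n) \<omega>) * f i \<omega>)" for i j
    by (rule Bochner_Integration.integrable_bound[OF f[of i]])
      (use f[of i] in \<open>auto simp: norm_mult\<close>)
  have "integrable M (\<lambda>\<omega>. f (min k (\<kappa> n \<omega>)) \<omega>) \<and> ?L k = ?R k"
  proof (induction k)
    case 0
    then show ?case using f by simp
  next
    case (Suc k)
    let ?g = "\<lambda>\<omega>. f (min k (\<kappa> n \<omega>)) \<omega> + (of_bool (alive (real k / 2 ^ n) \<omega>) * f (Suc k) \<omega>
      - of_bool (alive (real k / 2 ^ n) \<omega>) * f k \<omega>)"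
    have AE: "AE \<omega> in M. f (min (Suc k) (\<kappa> n \<omega>)) \<omega> = ?g \<omega>"
      using stopped_Suc_alive[of f k n] by eventually_elim (simp add: algebra_simps)
    have ig: "integrable M ?g"
      using Suc i by (intro Bochner_Integration.integrable_add Bochner_Integration.integrable_diff) auto
    have "?L (Suc k) = expectation ?g"
      using ig by (intro integral_cong_AE m AE) auto
    also have "\<dots> = ?R (Suc k)"
      using Suc i by (subst Bochner_Integration.integral_add)
       (auto simp: Bochner_Integration.integral_diff intro!: Bochner_Integration.integrable_diff)
    finally have "?L (Suc k) = ?R (Suc k)" .
    moreover have "integrable M (\<lambda>\<omega>. f (min (Suc k) (\<kappa> n \<omega>)) \<omega>)"
      using ig by (subst integrable_cong_AE[OF m _ AE]) auto
    ultimately show ?case by blast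
  qed
  then show "integrable M (\<lambda>\<omega>. f (min k (\<kappa> n \<omega>)) \<omega>)" "?L k = ?R k" by auto
qed

end

lemma hit_time_position:
  fixes f :: "real \<Rightarrow> real"
  assumes cont: "continuous_on {0..} f" and fin: "hit_time f < \<infinity>" and f0: "\<bar>f 0\<bar> < 1"
  defines "t \<equiv> enn2real (hit_time f)"
  shows "\<bar>f t\<bar> = 1" and "\<And>s. 0 \<le> s \<Longrightarrow> s \<le> t \<Longrightarrow> \<bar>f s\<bar> \<le> 1"
proof -
  obtain t' where t': "0 \<le> t'" "hit_time f = ennreal t'" "1 \<le> \<bar>f t'\<bar>"
    "\<And>s. 0 \<le> s \<Longrightarrow> s < t' \<Longrightarrow> \<bar>f s\<bar> < 1"
    using hit_time_attained[OF cont fin] by metis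
  have t: "t = t'" using t' by (simp add: t_def)
  have pos: "0 < t'" using t' f0 by (cases "t' = 0") auto
  have "\<bar>f t'\<bar> \<le> 1"
  proof (rule tendsto_upperbound)
    have "((\<lambda>s. \<bar>f s\<bar>) \<longlongrightarrow> \<bar>f t'\<bar>) (at t' within {0..})"
      using cont t'(1) by (intro tendsto_intros) (auto simp: continuous_on_def)
    moreover have "{0<..<t'} \<subseteq> {0..}" by auto
    ultimately show "((\<lambda>s. \<bar>f s\<bar>) \<longlongrightarrow> \<bar>f t'\<bar>) (at t' within {0<..<t'})"
      by (rule tendsto_within_subset)
    show "\<forall>\<^sub>F s in at t' within {0<..<t'}. \<bar>f s\<bar> \<le> 1"
      unfolding eventually_at_filter using t'(4) by (intro always_eventually) (auto intro: less_imp_le)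
    show "at t' within {0<..<t'} \<noteq> bot"
      using pos by (simp add: at_within_eq_bot_iff not_in_closure_trivial_limitI)
  qed
  with t'(3) show "\<bar>f t\<bar> = 1" by (simp add: t)
  then show "\<bar>f s\<bar> \<le> 1" if "0 \<le> s" "s \<le> t" for s
    using t'(4)[of s] that by (cases "s = t'") (auto simp: t)
qed

lemma measurable_at_random_time:
  fixes Y :: "real \<Rightarrow> 'a \<Rightarrow> 'b::metric_space"
  assumes Y: "\<And>t. 0 \<le> t \<Longrightarrow> Y t \<in> borel_measurable M"
    and cont: "\<And>\<omega>. \<omega> \<in> space M \<Longrightarrow> continuous_on {0..} (\<lambda>t. Y t \<omega>)"
    and s[measurable]: "s \<in> borel_measurable M" and nonneg: "\<And>\<omega>. 0 \<le> s \<omega>"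
  shows "(\<lambda>\<omega>. Y (s \<omega>) \<omega>) \<in> borel_measurable M"
proof (rule borel_measurable_LIMSEQ_metric)
  show "(\<lambda>\<omega>. Y (real (nat \<lceil>s \<omega> * 2 ^ n\<rceil>) / 2 ^ n) \<omega>) \<in> borel_measurable M" for n
    by (rule measurable_compose_countable[where f = "\<lambda>k. Y (real k / 2 ^ n)"
        and g = "\<lambda>\<omega>. nat \<lceil>s \<omega> * 2 ^ n\<rceil>"]) (auto intro!: Y)
  show "(\<lambda>n. Y (real (nat \<lceil>s \<omega> * 2 ^ n\<rceil>) / 2 ^ n) \<omega>) \<longlonglongrightarrow> Y (s \<omega>) \<omega>" if "\<omega> \<in> space M" for \<omega>
    by (rule tendsto_at_nonneg[OF cont[OF that] dyadic_ceiling(1)[OF nonneg] _ nonneg])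
      (intro divide_nonneg_nonneg of_nat_0_le_iff zero_le_power zero_le_numeral)
qed

context linear_brownian_motion
begin

lemma stopped_exponential:
  fixes l :: real and n :: nat
  defines "Z \<equiv> \<lambda>k \<omega>. exp (l * X (real k / 2 ^ n) \<omega> - l\<^sup>2 * (real k / 2 ^ n) / 2)"
  shows "integrable M (\<lambda>\<omega>. Z (min k (\<kappa> n \<omega>)) \<omega>)"
    and "expectation (\<lambda>\<omega>. Z (min k (\<kappa> n \<omega>)) \<omega>) = exp (l * x)"
proof -
  have Z: "Z k \<omega> = exp (- (l\<^sup>2 * (real k / 2 ^ n) / 2)) * exp (l * X (real k / 2 ^ n) \<omega>)" for k \<omega>
    by (simp add: Z_def exp_add[symmetric])
  have int: "integrable M (Z k)" for k
    unfolding Z by (intro integrable_mult_right exp_X) auto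
  show "integrable M (\<lambda>\<omega>. Z (min k (\<kappa> n \<omega>)) \<omega>)"
    by (rule stopped_expectation(1)[OF int])
  have step: "expectation (\<lambda>\<omega>. of_bool (alive (real j / 2 ^ n) \<omega>) * Z (Suc j) \<omega>) =
      expectation (\<lambda>\<omega>. of_bool (alive (real j / 2 ^ n) \<omega>) * Z j \<omega>)" for j
  proof -
    let ?r = "real j / 2 ^ n" and ?t = "real (Suc j) / 2 ^ n"
    have "expectation (\<lambda>\<omega>. of_bool (alive ?r \<omega>) * Z (Suc j) \<omega>) =
        exp (- (l\<^sup>2 * ?t / 2)) * expectation (\<lambda>\<omega>. of_bool (alive ?r \<omega>) * exp (l * X ?t \<omega>))"
      unfolding Z by (subst integral_mult_right_zero[symmetric]) (simp only: mult.left_commute)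
    also have "\<dots> = (exp (- (l\<^sup>2 * ?t / 2)) * exp (l\<^sup>2 * (?t - ?r) / 2)) *
        expectation (\<lambda>\<omega>. of_bool (alive ?r \<omega>) * exp (l * X ?r \<omega>))"
      by (subst alive_markov) (auto simp: divide_right_mono)
    also have "exp (- (l\<^sup>2 * ?t / 2)) * exp (l\<^sup>2 * (?t - ?r) / 2) = exp (- (l\<^sup>2 * ?r / 2))"
      by (simp add: exp_add[symmetric] field_simps)
    also have "exp (- (l\<^sup>2 * ?r / 2)) * expectation (\<lambda>\<omega>. of_bool (alive ?r \<omega>) * exp (l * X ?r \<omega>)) =
        expectation (\<lambda>\<omega>. of_bool (alive ?r \<omega>) * Z j \<omega>)"
      unfolding Z by (subst integral_mult_right_zero[symmetric]) (simp only: mult.left_commute)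
    finally show ?thesis .
  qed
  have "expectation (Z 0) = exp (l * x)"
    using exp_X(2)[of 0 l] by (simp add: Z_def)
  then show "expectation (\<lambda>\<omega>. Z (min k (\<kappa> n \<omega>)) \<omega>) = exp (l * x)"
    by (subst stopped_expectation(2)[OF int]) (simp add: step)
qed

lemma position_measurable:
  "s \<in> borel_measurable M \<Longrightarrow> (\<And>\<omega>. 0 \<le> s \<omega>) \<Longrightarrow> (\<lambda>\<omega>. X (s \<omega>) \<omega>) \<in> borel_measurable M"
  by (rule measurable_at_random_time) (auto intro: continuous_paths)

text \<open>The index \<open>\<kappa> n\<close> is at most one step late, so the rounded-up times tend to \<open>\<tau>\<close>. The second moment of the
  stopped exponential with parameter \<open>l\<close> is controlled up to a factor \<open>exp (l\<^sup>2 K)\<close> by the mean of the one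
  with parameter \<open>2 l\<close>. That factor makes a horizon \<open>K\<close> necessary; it is removed at the end, where the bound
  \<open>\<bar>X\<bar> \<le> 1\<close> up to the exit applies.\<close>
lemma exit_exponential:
  assumes x: "\<bar>x\<bar> < 1"
  shows "expectation (\<lambda>\<omega>. exp (l * X (\<tau> \<omega>) \<omega> - l\<^sup>2 * \<tau> \<omega> / 2)) = exp (l * x)"
proof -
  define W where "W K \<omega> = exp (l * X (min (real K) (\<tau> \<omega>)) \<omega> - l\<^sup>2 * min (real K) (\<tau> \<omega>) / 2)" for K \<omega>
  have [measurable]: "W K \<in> borel_measurable M" for K
  proof -
    have [measurable]: "(\<lambda>\<omega>. X (min (real K) (\<tau> \<omega>)) \<omega>) \<in> borel_measurable M"
      by (rule position_measurable) auto
    show ?thesis unfolding W_def by measurable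
  qed
  have inside: "AE \<omega> in M. \<forall>s\<in>{0..\<tau> \<omega>}. \<bar>X s \<omega>\<bar> \<le> 1"
    using start T_finite AE_space
  proof eventually_elim
    case (elim \<omega>)
    then show ?case
      using hit_time_position(2)[OF continuous_paths, of \<omega>] x unfolding \<tau>_def by auto
  qed
  have exp_bound: "exp (l * y - l\<^sup>2 * s / 2) \<le> exp \<bar>l\<bar>" if "\<bar>y\<bar> \<le> 1" "0 \<le> s" for y s
  proof -
    have "l * y \<le> \<bar>l * y\<bar>" by (rule abs_ge_self)
    also have "\<dots> \<le> \<bar>l\<bar> * 1"
      unfolding abs_mult by (rule mult_left_mono[OF that(1) abs_ge_zero])
    finally have "l * y \<le> \<bar>l\<bar> * 1" .
    moreover have "0 \<le> l\<^sup>2 * s / 2" using that by simp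
    ultimately show ?thesis by simp
  qed
  have W_bound: "AE \<omega> in M. norm (W K \<omega>) \<le> exp \<bar>l\<bar>" for K
    using inside
  proof eventually_elim
    case (elim \<omega>)
    then show ?case
      unfolding W_def using exp_bound[of "X (min (real K) (\<tau> \<omega>)) \<omega>" "min (real K) (\<tau> \<omega>)"] by simp
  qed
  have EW: "expectation (W K) = exp (l * x)" for K
  proof -
    define V where "V n \<omega> = exp (l * X (real (min (K * 2 ^ n) (\<kappa> n \<omega>)) / 2 ^ n) \<omega>
      - l\<^sup>2 * (real (min (K * 2 ^ n) (\<kappa> n \<omega>)) / 2 ^ n) / 2)" for n \<omega>
    define V2 where "V2 n \<omega> = exp ((2 * l) * X (real (min (K * 2 ^ n) (\<kappa> n \<omega>)) / 2 ^ n) \<omega>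
      - (2 * l)\<^sup>2 * (real (min (K * 2 ^ n) (\<kappa> n \<omega>)) / 2 ^ n) / 2)" for n \<omega>
    have V: "integrable M (V n)" "expectation (V n) = exp (l * x)" for n
      unfolding V_def[abs_def] by (fact stopped_exponential)+
    have V2: "integrable M (V2 n)" "expectation (V2 n) = exp (2 * l * x)" for n
      unfolding V2_def[abs_def] by (fact stopped_exponential)+
    have le: "(V n \<omega>)\<^sup>2 \<le> exp (l\<^sup>2 * real K) * V2 n \<omega>" for n \<omega>
    proof -
      define s where "s = real (min (K * 2 ^ n) (\<kappa> n \<omega>)) / 2 ^ n"
      have "real (min (K * 2 ^ n) (\<kappa> n \<omega>)) \<le> real (K * 2 ^ n)"
        by (subst of_nat_le_iff) simp
      then have "s \<le> real K" by (simp add: s_def field_simps)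
      then have "l\<^sup>2 * s \<le> l\<^sup>2 * real K" by (intro mult_left_mono) auto
      then show ?thesis
        unfolding V_def V2_def s_def[symmetric]
        by (simp add: exp_add[symmetric] power2_eq_square algebra_simps flip: exp_double)
    qed
    have iV: "integrable M (\<lambda>\<omega>. (V n \<omega>)\<^sup>2)" for n
      by (rule Bochner_Integration.integrable_bound[OF integrable_mult_right[OF V2(1)[of n], of "exp (l\<^sup>2 * real K)"]])
        (use V(1)[of n] le[of n] in \<open>auto simp: V2_def\<close>)
    show ?thesis
    proof (rule expectation_limit_of_L2_bounded[where V = V and C = "exp (l\<^sup>2 * real K) * exp (2 * l * x)"
          and b = "exp \<bar>l\<bar>"])
      show "expectation (\<lambda>\<omega>. (V n \<omega>)\<^sup>2) \<le> exp (l\<^sup>2 * real K) * exp (2 * l * x)" for n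
        unfolding V2(2)[of n, symmetric]
        by (subst integral_mult_right_zero[symmetric])
          (intro integral_mono iV integrable_mult_right V2 le)
      show "AE \<omega> in M. (\<lambda>n. V n \<omega>) \<longlonglongrightarrow> W K \<omega>"
        using AE_space
      proof eventually_elim
        case (elim \<omega>)
        have s: "(\<lambda>n. real (min (K * 2 ^ n) (\<kappa> n \<omega>)) / 2 ^ n) \<longlonglongrightarrow> min (real K) (\<tau> \<omega>)"
          unfolding \<kappa>_def by (rule dyadic_ceiling(2)) simp
        have "(\<lambda>n. X (real (min (K * 2 ^ n) (\<kappa> n \<omega>)) / 2 ^ n) \<omega>) \<longlonglongrightarrow> X (min (real K) (\<tau> \<omega>)) \<omega>"
          by (rule tendsto_at_nonneg[OF continuous_paths[OF elim] s]) auto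
        then show ?case
          unfolding V_def W_def by (intro tendsto_exp tendsto_diff tendsto_mult tendsto_divide tendsto_const s) auto
      qed
      show "AE \<omega> in M. W K \<omega> \<le> exp \<bar>l\<bar>"
        using W_bound[of K] by eventually_elim auto
    qed (use V iV in \<open>auto simp: V_def\<close>)
  qed
  have mX[measurable]: "(\<lambda>\<omega>. X (\<tau> \<omega>) \<omega>) \<in> borel_measurable M"
    by (rule position_measurable) auto
  have "(\<lambda>K. expectation (W K)) \<longlonglongrightarrow> expectation (\<lambda>\<omega>. exp (l * X (\<tau> \<omega>) \<omega> - l\<^sup>2 * \<tau> \<omega> / 2))"
  proof (rule integral_dominated_convergence[where w = "\<lambda>_. exp \<bar>l\<bar>"])
    show "AE \<omega> in M. (\<lambda>K. W K \<omega>) \<longlonglongrightarrow> exp (l * X (\<tau> \<omega>) \<omega> - l\<^sup>2 * \<tau> \<omega> / 2)"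
    proof (rule AE_I2, rule tendsto_eventually)
      fix \<omega>
      have "\<forall>\<^sub>F K in sequentially. \<tau> \<omega> \<le> real K"
        by (meson eventually_sequentiallyI nat_ceiling_le_eq)
      then show "\<forall>\<^sub>F K in sequentially. W K \<omega> = exp (l * X (\<tau> \<omega>) \<omega> - l\<^sup>2 * \<tau> \<omega> / 2)"
        by eventually_elim (simp add: W_def min_absorb2)
    qed
  qed (use W_bound in auto)
  then show ?thesis unfolding EW by (simp add: LIMSEQ_const_iff)
qed

end

section \<open>Exit of the planar motion: Fourier transform on each boundary line\<close>

context planar_brownian_motion
begin

sublocale re: linear_brownian_motion M "\<lambda>t \<omega>. Re (B t \<omega>)" "Re a" by (rule Re_brownian)
sublocale im: linear_brownian_motion M "\<lambda>t \<omega>. Im (B t \<omega>)" "Im a" by (rule Im_brownian)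

lemma Im_char:
  assumes t: "0 \<le> t" and a: "Im a = 0"
  shows "expectation (\<lambda>\<omega>. exp (\<i> * of_real (b * Im (B t \<omega>)))) = of_real (exp (- (b\<^sup>2 * t / 2)))"
proof -
  have [measurable]: "(\<lambda>\<omega>. Im (B t \<omega>)) \<in> borel_measurable M" "(\<lambda>\<omega>. Im (B 0 \<omega>)) \<in> borel_measurable M"
    using t by auto
  have "expectation (\<lambda>\<omega>. exp (\<i> * of_real (b * Im (B t \<omega>)))) =
      expectation (\<lambda>\<omega>. exp (\<i> * of_real (b * (Im (B t \<omega>) - Im (B 0 \<omega>)))))"
    by (rule integral_cong_AE) (use im.start a in \<open>auto elim: eventually_mono\<close>)
  also have "\<dots> = of_real (exp (- (b\<^sup>2 * t / 2)))"
  proof (cases "t = 0")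
    case True
    then show ?thesis by (simp add: prob_space)
  next
    case False
    with t have "0 < t" by simp
    from distributed_normal_char[OF prob_space_axioms im.gaussian_increments[OF order.refl this], of b] t False
    show ?thesis by simp
  qed
  finally show ?thesis .
qed

text \<open>Survival and the real part at time \<open>t\<close> are functions of the path of the real part, hence independent of
  the imaginary part at time \<open>t\<close>, which can be averaged out.\<close>
lemma alive_Im_independent:
  fixes h :: "real \<Rightarrow> real"
  assumes r: "0 \<le> r" and t: "0 \<le> t" and a: "Im a = 0"
    and h[measurable]: "h \<in> borel_measurable borel" and hb: "\<And>y. \<bar>h y\<bar> \<le> C"
  shows "expectation (\<lambda>\<omega>. of_bool (re.alive r \<omega>) * (of_real (h (Re (B t \<omega>))) * exp (\<i> * of_real (b * Im (B t \<omega>))))) =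
    expectation (\<lambda>\<omega>. of_bool (re.alive r \<omega>) * (of_real (h (Re (B t \<omega>))) * complex_of_real (exp (- (b\<^sup>2 * t / 2)))))"
proof -
  define F :: "(real \<Rightarrow> real) \<Rightarrow> complex" where
    "F v = of_bool (\<exists>m. \<forall>N. \<forall>j\<in>{..(2::nat) ^ N}. \<bar>v (real j * r / 2 ^ N)\<bar> \<le> 1 - 1 / real (Suc m)) * of_real (h (v t))" for v
  have [measurable]: "(\<lambda>v. v (real j * r / 2 ^ N)) \<in> borel_measurable (PiM {0..} (\<lambda>_. borel))" for j N
    using r by (intro measurable_component_singleton) auto
  have [measurable]: "(\<lambda>v. v t) \<in> borel_measurable (PiM {0..} (\<lambda>_. borel))"
    using t by (intro measurable_component_singleton) auto
  have F: "F \<in> borel_measurable (PiM {0..} (\<lambda>_. borel))"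
    unfolding F_def by measurable
  define E :: "(real \<Rightarrow> real) \<Rightarrow> complex" where "E v = exp (\<i> * of_real (b * v t))" for v
  have E: "E \<in> borel_measurable (PiM {0..} (\<lambda>_. borel))"
    unfolding E_def by measurable
  have F_eq: "F (\<lambda>t\<in>{0..}. Re (B t \<omega>)) = of_bool (re.alive r \<omega>) * of_real (h (Re (B t \<omega>)))" if "\<omega> \<in> space M" for \<omega>
    using r t re.alive_iff[OF that r] unfolding F_def by (simp add: Ball_def)
  have ind: "indep_var borel (\<lambda>\<omega>. F (\<lambda>t\<in>{0..}. Re (B t \<omega>))) borel (\<lambda>\<omega>. exp (\<i> * of_real (b * Im (B t \<omega>))))"
    using indep_var_compose[OF indep_Re_Im F E] t by (simp add: comp_def E_def)
  have "cmod (F v) \<le> C" for v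
  proof -
    have "cmod (of_bool P * z) \<le> cmod z" for P z by (cases P) auto
    from this[of _ "of_real (h (v t))"] have "cmod (F v) \<le> \<bar>h (v t)\<bar>"
      unfolding F_def by simp
    with hb show ?thesis by (rule order_trans[rotated])
  qed
  then have iF: "integrable M (\<lambda>\<omega>. F (\<lambda>t\<in>{0..}. Re (B t \<omega>)))"
    using indep_var_rv1[OF ind] by (intro integrable_const_bound[where B = C] AE_I2)
  have iE: "integrable M (\<lambda>\<omega>. exp (\<i> * of_real (b * Im (B t \<omega>))))"
    by (rule integrable_const_bound[where B = 1]) (use indep_var_rv2[OF ind] in auto)
  have "expectation (\<lambda>\<omega>. of_bool (re.alive r \<omega>) * (of_real (h (Re (B t \<omega>))) * exp (\<i> * of_real (b * Im (B t \<omega>))))) =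
      expectation (\<lambda>\<omega>. F (\<lambda>t\<in>{0..}. Re (B t \<omega>)) * exp (\<i> * of_real (b * Im (B t \<omega>))))"
    by (intro Bochner_Integration.integral_cong refl) (simp add: F_eq mult.assoc)
  also have "\<dots> = expectation (\<lambda>\<omega>. F (\<lambda>t\<in>{0..}. Re (B t \<omega>))) * of_real (exp (- (b\<^sup>2 * t / 2)))"
    unfolding indep_var_lebesgue_integral[OF ind iF iE] by (simp only: Im_char[OF t a])
  also have "\<dots> = expectation (\<lambda>\<omega>. F (\<lambda>t\<in>{0..}. Re (B t \<omega>)) * of_real (exp (- (b\<^sup>2 * t / 2))))"
    by (rule integral_mult_left_zero[symmetric])
  also have "\<dots> = expectation (\<lambda>\<omega>. of_bool (re.alive r \<omega>) * (of_real (h (Re (B t \<omega>))) * complex_of_real (exp (- (b\<^sup>2 * t / 2)))))"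
    by (intro Bochner_Integration.integral_cong refl) (simp add: F_eq mult.assoc)
  finally show ?thesis .
qed

text \<open>Given the real part, hence \<open>\<tau>\<close>, the imaginary part at time \<open>\<tau>\<close> is centred normal with variance \<open>\<tau>\<close>.
  On the grid the two sides are stopped expectations of sequences that agree on every survival event.\<close>
lemma exit_Fourier_Laplace:
  fixes h :: "real \<Rightarrow> real"
  assumes a: "Im a = 0" and h: "continuous_on UNIV h" and hb: "\<And>y. \<bar>h y\<bar> \<le> C"
  shows "expectation (\<lambda>\<omega>. of_real (h (Re (B (re.\<tau> \<omega>) \<omega>))) * exp (\<i> * of_real (b * Im (B (re.\<tau> \<omega>) \<omega>)))) =
    expectation (\<lambda>\<omega>. of_real (h (Re (B (re.\<tau> \<omega>) \<omega>))) * complex_of_real (exp (- (b\<^sup>2 * re.\<tau> \<omega> / 2))))"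
proof -
  define f where "f n k \<omega> = of_real (h (Re (B (real k / 2 ^ n) \<omega>))) * exp (\<i> * of_real (b * Im (B (real k / 2 ^ n) \<omega>)))"
    for n k :: nat and \<omega>
  define g where "g n k \<omega> = of_real (h (Re (B (real k / 2 ^ n) \<omega>))) * complex_of_real (exp (- (b\<^sup>2 * (real k / 2 ^ n) / 2)))"
    for n k :: nat and \<omega>
  have hm[measurable]: "h \<in> borel_measurable borel"
    by (rule borel_measurable_continuous_onI[OF h])
  have [measurable]: "(\<lambda>\<omega>. Re (B (real k / 2 ^ n) \<omega>)) \<in> borel_measurable M"
    "(\<lambda>\<omega>. Im (B (real k / 2 ^ n) \<omega>)) \<in> borel_measurable M" for k n :: nat
    by auto
  have fm[measurable]: "f n k \<in> borel_measurable M" "g n k \<in> borel_measurable M" for n k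
    unfolding f_def g_def by measurable
  have fb: "cmod (f n k \<omega>) \<le> C" "cmod (g n k \<omega>) \<le> C" for n k \<omega>
  proof -
    show "cmod (f n k \<omega>) \<le> C" using hb by (simp add: f_def norm_mult)
    have "exp (- (b\<^sup>2 * (real k / 2 ^ n) / 2)) \<le> 1" by simp
    from mult_mono[OF hb this] show "cmod (g n k \<omega>) \<le> C"
      by (simp add: g_def norm_mult order_trans[OF abs_ge_zero hb])
  qed
  have int: "integrable M (f n k)" "integrable M (g n k)" for n k
    by (auto intro!: integrable_const_bound[where B = C] fb)
  have eq0: "expectation (f n 0) = expectation (g n 0)" for n
    by (rule integral_cong_AE) (use im.start a in \<open>auto simp: f_def g_def elim!: eventually_mono\<close>)
  have fg: "expectation (\<lambda>\<omega>. of_bool (re.alive (real j / 2 ^ n) \<omega>) * f n k \<omega>) =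
      expectation (\<lambda>\<omega>. of_bool (re.alive (real j / 2 ^ n) \<omega>) * g n k \<omega>)" for j n k
    unfolding f_def g_def by (rule alive_Im_independent[OF _ _ a hm hb]) auto
  have stopped: "expectation (\<lambda>\<omega>. f n (min k (re.\<kappa> n \<omega>)) \<omega>) = expectation (\<lambda>\<omega>. g n (min k (re.\<kappa> n \<omega>)) \<omega>)" for n k
    unfolding re.stopped_expectation(2)[of "f n", OF int(1)] re.stopped_expectation(2)[of "g n", OF int(2)]
    by (simp add: fg eq0)
  have times: "(\<lambda>n. real (min (n * 2 ^ n) (re.\<kappa> n \<omega>)) / 2 ^ n) \<longlonglongrightarrow> re.\<tau> \<omega>" for \<omega>
    unfolding re.\<kappa>_def by (rule dyadic_ceiling(3)) simp
  have positions: "(\<lambda>n. Re (B (real (min (n * 2 ^ n) (re.\<kappa> n \<omega>)) / 2 ^ n) \<omega>)) \<longlonglongrightarrow> Re (B (re.\<tau> \<omega>) \<omega>)"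
    "(\<lambda>n. Im (B (real (min (n * 2 ^ n) (re.\<kappa> n \<omega>)) / 2 ^ n) \<omega>)) \<longlonglongrightarrow> Im (B (re.\<tau> \<omega>) \<omega>)" if "\<omega> \<in> space M" for \<omega>
    by (rule tendsto_at_nonneg[OF re.continuous_paths[OF that] times]
        tendsto_at_nonneg[OF im.continuous_paths[OF that] times]; simp)+
  have hpos: "(\<lambda>n. h (Re (B (real (min (n * 2 ^ n) (re.\<kappa> n \<omega>)) / 2 ^ n) \<omega>))) \<longlonglongrightarrow> h (Re (B (re.\<tau> \<omega>) \<omega>))"
    if "\<omega> \<in> space M" for \<omega>
    by (rule continuous_on_tendsto_compose[OF h positions(1)[OF that]]) auto
  have [measurable]: "(\<lambda>\<omega>. Re (B (re.\<tau> \<omega>) \<omega>)) \<in> borel_measurable M"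
    by (rule re.position_measurable) auto
  have [measurable]: "(\<lambda>\<omega>. Im (B (re.\<tau> \<omega>) \<omega>)) \<in> borel_measurable M"
    by (rule im.position_measurable) auto
  have "(\<lambda>n. expectation (\<lambda>\<omega>. f n (min (n * 2 ^ n) (re.\<kappa> n \<omega>)) \<omega>)) \<longlonglongrightarrow>
      expectation (\<lambda>\<omega>. of_real (h (Re (B (re.\<tau> \<omega>) \<omega>))) * exp (\<i> * of_real (b * Im (B (re.\<tau> \<omega>) \<omega>))))"
  proof (rule integral_dominated_convergence[where w = "\<lambda>_. C"])
    show "AE \<omega> in M. (\<lambda>n. f n (min (n * 2 ^ n) (re.\<kappa> n \<omega>)) \<omega>) \<longlonglongrightarrow>
        of_real (h (Re (B (re.\<tau> \<omega>) \<omega>))) * exp (\<i> * of_real (b * Im (B (re.\<tau> \<omega>) \<omega>)))"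
      unfolding f_def
      by (intro AE_I2 tendsto_mult tendsto_exp tendsto_of_real tendsto_const hpos positions)
    show "(\<lambda>\<omega>. f n (min (n * 2 ^ n) (re.\<kappa> n \<omega>)) \<omega>) \<in> borel_measurable M" for n
      by (rule re.stopped_measurable) (rule fm)
  qed (auto intro!: AE_I2 fb)
  moreover have "(\<lambda>n. expectation (\<lambda>\<omega>. g n (min (n * 2 ^ n) (re.\<kappa> n \<omega>)) \<omega>)) \<longlonglongrightarrow>
      expectation (\<lambda>\<omega>. of_real (h (Re (B (re.\<tau> \<omega>) \<omega>))) * complex_of_real (exp (- (b\<^sup>2 * re.\<tau> \<omega> / 2))))"
  proof (rule integral_dominated_convergence[where w = "\<lambda>_. C"])
    show "AE \<omega> in M. (\<lambda>n. g n (min (n * 2 ^ n) (re.\<kappa> n \<omega>)) \<omega>) \<longlonglongrightarrow>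
        of_real (h (Re (B (re.\<tau> \<omega>) \<omega>))) * complex_of_real (exp (- (b\<^sup>2 * re.\<tau> \<omega> / 2)))"
      unfolding g_def
      by (intro AE_I2 tendsto_mult tendsto_exp tendsto_of_real tendsto_const hpos tendsto_minus
          tendsto_divide times) auto
    show "(\<lambda>\<omega>. g n (min (n * 2 ^ n) (re.\<kappa> n \<omega>)) \<omega>) \<in> borel_measurable M" for n
      by (rule re.stopped_measurable) (rule fm)
  qed (auto intro!: AE_I2 fb)
  ultimately show ?thesis unfolding stopped by (rule LIMSEQ_unique)
qed

lemma exit_boundary:
  assumes "\<bar>Re a\<bar> < 1"
  shows "AE \<omega> in M. \<bar>Re (B (re.\<tau> \<omega>) \<omega>)\<bar> = 1"
  using re.start re.T_finite AE_space
proof eventually_elim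
  case (elim \<omega>)
  then show ?case
    using hit_time_position(1)[OF re.continuous_paths, of \<omega>] assms unfolding re.\<tau>_def by auto
qed

text \<open>The freedom in the sign of \<open>b\<close> covers the functions \<open>exp (l z)\<close> and \<open>exp (l cnj z)\<close> alike.\<close>
lemma exit_exponential_planar:
  assumes a: "Im a = 0" "\<bar>Re a\<bar> < 1" and b: "b\<^sup>2 = l\<^sup>2"
  shows "expectation (\<lambda>\<omega>. of_real (exp (l * Re (B (re.\<tau> \<omega>) \<omega>))) * exp (\<i> * of_real (b * Im (B (re.\<tau> \<omega>) \<omega>)))) =
    complex_of_real (exp (l * Re a))"
proof -
  \<comment> \<open>the exponential, made bounded outside the values that the real part takes at the exit\<close>
  define h where "h y = exp (l * max (- 1) (min 1 y))" for y :: real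
  have h: "continuous_on UNIV h" unfolding h_def by (intro continuous_intros)
  have hb: "\<bar>h y\<bar> \<le> exp \<bar>l\<bar>" for y
  proof -
    have "l * max (- 1) (min 1 y) \<le> \<bar>l * max (- 1) (min 1 y)\<bar>" by (rule abs_ge_self)
    also have "\<dots> \<le> \<bar>l\<bar> * 1"
      unfolding abs_mult by (rule mult_left_mono) auto
    finally have "l * max (- 1) (min 1 y) \<le> \<bar>l\<bar> * 1" .
    then show ?thesis by (simp add: h_def)
  qed
  have [measurable]: "(\<lambda>\<omega>. Re (B (re.\<tau> \<omega>) \<omega>)) \<in> borel_measurable M"
    by (rule re.position_measurable) auto
  have [measurable]: "(\<lambda>\<omega>. Im (B (re.\<tau> \<omega>) \<omega>)) \<in> borel_measurable M"
    by (rule im.position_measurable) auto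
  have [measurable]: "h \<in> borel_measurable borel"
    by (rule borel_measurable_continuous_onI[OF h])
  have h_eq: "AE \<omega> in M. h (Re (B (re.\<tau> \<omega>) \<omega>)) = exp (l * Re (B (re.\<tau> \<omega>) \<omega>))"
    using exit_boundary[OF a(2)] by eventually_elim (auto simp: h_def)
  have "expectation (\<lambda>\<omega>. of_real (exp (l * Re (B (re.\<tau> \<omega>) \<omega>))) * exp (\<i> * of_real (b * Im (B (re.\<tau> \<omega>) \<omega>)))) =
      expectation (\<lambda>\<omega>. of_real (h (Re (B (re.\<tau> \<omega>) \<omega>))) * exp (\<i> * of_real (b * Im (B (re.\<tau> \<omega>) \<omega>))))"
    by (rule integral_cong_AE) (use h_eq in \<open>auto elim!: eventually_mono\<close>)
  also have "\<dots> = expectation (\<lambda>\<omega>. of_real (h (Re (B (re.\<tau> \<omega>) \<omega>))) * complex_of_real (exp (- (b\<^sup>2 * re.\<tau> \<omega> / 2))))"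
    by (rule exit_Fourier_Laplace[OF a(1) h hb])
  also have "\<dots> = expectation (\<lambda>\<omega>. complex_of_real (exp (l * Re (B (re.\<tau> \<omega>) \<omega>) - l\<^sup>2 * re.\<tau> \<omega> / 2)))"
  proof (rule integral_cong_AE)
    show "AE \<omega> in M. of_real (h (Re (B (re.\<tau> \<omega>) \<omega>))) * complex_of_real (exp (- (b\<^sup>2 * re.\<tau> \<omega> / 2))) =
        complex_of_real (exp (l * Re (B (re.\<tau> \<omega>) \<omega>) - l\<^sup>2 * re.\<tau> \<omega> / 2))"
      using h_eq
    proof eventually_elim
      case (elim \<omega>)
      show ?case unfolding elim of_real_mult[symmetric] exp_add[symmetric] b by simp
    qed
  qed auto
  also have "\<dots> = complex_of_real (exp (l * Re a))"
    unfolding integral_complex_of_real by (simp only: re.exit_exponential[OF a(2)])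
  finally show ?thesis .
qed

text \<open>On the values \<open>u \<in> {1, - 1}\<close> the indicator of \<open>u = e\<close> equals \<open>sinh (l (u + e)) / sinh (2 l e)\<close>, a
  combination of \<open>exp (l u)\<close> and \<open>exp (- l u)\<close>.\<close>
lemma exit_side_Fourier:
  assumes a: "Im a = 0" "\<bar>Re a\<bar> < 1" and e: "e \<in> {1, - 1}" and l: "l \<noteq> 0"
  shows "expectation (\<lambda>\<omega>. of_bool (Re (B (re.\<tau> \<omega>) \<omega>) = e) * exp (\<i> * of_real (l * Im (B (re.\<tau> \<omega>) \<omega>)))) =
    complex_of_real (sinh (l * (1 + e * Re a)) / sinh (2 * l))"
proof -
  have [measurable]: "(\<lambda>\<omega>. Re (B (re.\<tau> \<omega>) \<omega>)) \<in> borel_measurable M"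
    by (rule re.position_measurable) auto
  have [measurable]: "(\<lambda>\<omega>. Im (B (re.\<tau> \<omega>) \<omega>)) \<in> borel_measurable M"
    by (rule im.position_measurable) auto
  define E where "E k \<omega> = complex_of_real (exp (k * Re (B (re.\<tau> \<omega>) \<omega>))) * exp (\<i> * of_real (l * Im (B (re.\<tau> \<omega>) \<omega>)))" for k \<omega>
  have [measurable]: "E k \<in> borel_measurable M" for k unfolding E_def by measurable
  have int: "integrable M (E k)" for k
  proof (rule integrable_const_bound[where B = "exp \<bar>k\<bar>"])
    show "AE \<omega> in M. cmod (E k \<omega>) \<le> exp \<bar>k\<bar>"
      using exit_boundary[OF a(2)]
    proof eventually_elim
      case (elim \<omega>)
      have "k * Re (B (re.\<tau> \<omega>) \<omega>) \<le> \<bar>k\<bar>"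
        by (rule order_trans[OF abs_ge_self]) (simp add: abs_mult elim)
      then show ?case by (simp add: E_def norm_mult)
    qed
  qed simp
  have s0e: "sinh (2 * (l * e)) \<noteq> 0" using l e by auto
  have "expectation (\<lambda>\<omega>. of_bool (Re (B (re.\<tau> \<omega>) \<omega>) = e) * exp (\<i> * of_real (l * Im (B (re.\<tau> \<omega>) \<omega>)))) =
      expectation (\<lambda>\<omega>. of_real (exp (l * e) / (2 * sinh (2 * (l * e)))) * E l \<omega>
        - of_real (exp (- (l * e)) / (2 * sinh (2 * (l * e)))) * E (- l) \<omega>)"
  proof (rule integral_cong_AE)
    show "AE \<omega> in M. of_bool (Re (B (re.\<tau> \<omega>) \<omega>) = e) * exp (\<i> * of_real (l * Im (B (re.\<tau> \<omega>) \<omega>))) =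
        of_real (exp (l * e) / (2 * sinh (2 * (l * e)))) * E l \<omega>
        - of_real (exp (- (l * e)) / (2 * sinh (2 * (l * e)))) * E (- l) \<omega>"
      using exit_boundary[OF a(2)]
    proof eventually_elim
      case (elim \<omega>)
      define u where "u = Re (B (re.\<tau> \<omega>) \<omega>)"
      have indicator_eq: "of_bool (u = e) = exp (l * e) / (2 * sinh (2 * (l * e))) * exp (l * u)
          - exp (- (l * e)) / (2 * sinh (2 * (l * e))) * exp (- l * u)"
      proof (cases "u = e")
        case True
        have "exp (l * e) * exp (l * e) - exp (- (l * e)) * exp (- (l * e)) = 2 * sinh (2 * (l * e))"
          by (simp add: sinh_field_def exp_add[symmetric] ac_simps)
        with True s0e show ?thesis by (simp add: field_simps)
      next
        case False
        with elim e have "u = - e" unfolding u_def[symmetric] by auto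
        then show ?thesis using False by (simp add: exp_minus)
      qed
      have ob: "complex_of_real (of_bool P) = of_bool P" for P by (cases P) auto
      from arg_cong[OF indicator_eq, of complex_of_real]
      have "of_bool (u = e) = of_real (exp (l * e) / (2 * sinh (2 * (l * e)))) * complex_of_real (exp (l * u))
          - of_real (exp (- (l * e)) / (2 * sinh (2 * (l * e)))) * complex_of_real (exp (- l * u))"
        by (simp only: ob of_real_diff of_real_mult)
      then show ?case
        unfolding E_def u_def[symmetric] by (simp only: left_diff_distrib mult.assoc)
    qed
  qed auto
  also have "\<dots> = of_real (exp (l * e) / (2 * sinh (2 * (l * e)))) * expectation (E l)
        - of_real (exp (- (l * e)) / (2 * sinh (2 * (l * e)))) * expectation (E (- l))"
    using int by simp
  also have "expectation (E l) = of_real (exp (l * Re a))"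
    unfolding E_def by (rule exit_exponential_planar[OF a refl])
  also have "expectation (E (- l)) = of_real (exp (- l * Re a))"
    unfolding E_def by (rule exit_exponential_planar[OF a]) simp
  also have "of_real (exp (l * e) / (2 * sinh (2 * (l * e)))) * of_real (exp (l * Re a))
        - of_real (exp (- (l * e)) / (2 * sinh (2 * (l * e)))) * complex_of_real (exp (- l * Re a)) =
      of_real ((exp (l * e + l * Re a) - exp (- (l * e + l * Re a))) / (2 * sinh (2 * (l * e))))"
  proof -
    have "exp (l * e + l * Re a) = exp (l * e) * exp (l * Re a)"
      "exp (- (l * e + l * Re a)) = exp (- (l * e)) * exp (- l * Re a)"
      by (simp_all add: exp_add[symmetric])
    then show ?thesis
      unfolding of_real_mult[symmetric] of_real_diff[symmetric] of_real_eq_iff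
      by (simp only: times_divide_eq_left diff_divide_distrib)
  qed
  also have "(exp (l * e + l * Re a) - exp (- (l * e + l * Re a))) / (2 * sinh (2 * (l * e))) =
      sinh (l * e + l * Re a) / sinh (2 * (l * e))"
    by (simp add: sinh_field_def)
  also have "\<dots> = sinh (l * (1 + e * Re a)) / sinh (2 * l)"
  proof (cases "e = 1")
    case False
    with e have "e = - 1" by auto
    then have "sinh (l * e + l * Re a) = sinh (- (l * (1 + e * Re a)))"
      "sinh (2 * (l * e)) = sinh (- (2 * l))"
      by (simp_all add: algebra_simps)
    then show ?thesis by (simp only: sinh_minus minus_divide_divide)
  qed (simp add: algebra_simps)
  finally show ?thesis .
qed

end

section \<open>The Poisson kernel of the strip\<close>

lemma laplace_one_sided:
  assumes s: "0 < Re s"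
  shows "has_bochner_integral lborel (\<lambda>t. indicator {0<..} t *\<^sub>R exp (- (s * of_real t))) (1 / s)"
proof -
  have s0: "s \<noteq> 0" using s by auto
  have int: "set_integrable lborel {0<..} (\<lambda>t. exp (- (s * of_real t)))"
    unfolding set_integrable_def
    by (rule Bochner_Integration.integrable_bound[OF integrable_I0i_exp_mscale[OF s, unfolded set_integrable_def]])
      (auto simp: mult.commute)
  have "(CLBINT t=0..\<infinity>. exp (- (s * of_real t))) = 0 - (- exp (- (s * of_real 0)) / s)"
  proof (rule interval_integral_FTC_integrable[where F = "\<lambda>t. - exp (- (s * of_real t)) / s"])
    show "((\<lambda>t. - exp (- (s * of_real t)) / s) has_vector_derivative exp (- (s * of_real x))) (at x)" for x
      by (rule has_vector_derivative_real_field) (use s0 in \<open>auto intro!: derivative_eq_intros\<close>)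
    show "isCont (\<lambda>t. exp (- (s * complex_of_real t))) x" for x
      by (intro continuous_intros)
    show "set_integrable lborel (einterval 0 \<infinity>) (\<lambda>t. exp (- (s * complex_of_real t)))"
      using int by (simp add: einterval_def greaterThan_def zero_ereal_def)
    have "((\<lambda>t. - exp (- (s * complex_of_real t)) / s) \<longlongrightarrow> - exp (- (s * of_real 0)) / s) (at_right 0)"
      by (intro tendsto_intros s0)
    then show "(((\<lambda>t. - exp (- (s * complex_of_real t)) / s) \<circ> real_of_ereal) \<longlongrightarrow> - exp (- (s * of_real 0)) / s) (at_right 0)"
      by (simp add: zero_ereal_def ereal_tendsto_simps)
    have "((\<lambda>t. exp (- (Re s * t)) / cmod s) \<longlongrightarrow> 0 / cmod s) at_top"
      by (intro tendsto_divide tendsto_const filterlim_compose[OF exp_at_bot])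
        (use s s0 in \<open>auto intro!: filterlim_uminus_at_bot_at_top[THEN filterlim_compose] filterlim_tendsto_pos_mult_at_top[OF tendsto_const] filterlim_ident\<close>)
    then have "((\<lambda>t. cmod (- exp (- (s * complex_of_real t)) / s)) \<longlongrightarrow> 0) at_top"
      by (simp add: norm_divide)
    then have "((\<lambda>t. - exp (- (s * complex_of_real t)) / s) \<longlongrightarrow> 0) at_top"
      by (rule tendsto_norm_zero_cancel)
    then show "(((\<lambda>t. - exp (- (s * complex_of_real t)) / s) \<circ> real_of_ereal) \<longlongrightarrow> 0) (at_left \<infinity>)"
      by (simp add: ereal_tendsto_simps)
  qed simp
  then have "(CLBINT t:{0<..}. exp (- (s * of_real t))) = 1 / s"
    by (simp add: interval_lebesgue_integral_0_infty)
  with int show ?thesis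
    by (simp add: has_bochner_integral_iff set_integrable_def set_lebesgue_integral_def)
qed

text \<open>The two half-lines contribute \<open>1 / (c + \<i> y)\<close> and its conjugate.\<close>
lemma fourier_exp_abs:
  assumes c: "0 < c"
  shows "has_bochner_integral lborel (\<lambda>t. exp (\<i> * of_real (- (t * y))) * of_real (exp (- (c * \<bar>t\<bar>))))
    (complex_of_real (2 * (c / (c\<^sup>2 + y\<^sup>2))))"
proof -
  define f where "f s t = indicator {0<..} t *\<^sub>R exp (- (s * complex_of_real t))" for s t
  have "has_bochner_integral lborel (f (Complex c y)) (1 / Complex c y)"
    unfolding f_def using c by (intro laplace_one_sided) simp
  moreover have "has_bochner_integral lborel (\<lambda>t. f (Complex c (- y)) (0 + (- 1) * t)) ((1 / Complex c (- y)) /\<^sub>R \<bar>- 1\<bar>)"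
    unfolding f_def using c
    by (subst lborel_has_bochner_integral_real_affine_iff[symmetric]) (auto intro!: laplace_one_sided)
  ultimately have "has_bochner_integral lborel (\<lambda>t. f (Complex c y) t + f (Complex c (- y)) (0 + (- 1) * t))
      (1 / Complex c y + (1 / Complex c (- y)) /\<^sub>R \<bar>- 1\<bar>)"
    by (rule has_bochner_integral_add)
  also have "1 / Complex c y + (1 / Complex c (- y)) /\<^sub>R \<bar>- 1\<bar> = complex_of_real (2 * (c / (c\<^sup>2 + y\<^sup>2)))"
  proof -
    have prod: "Complex c y * Complex c (- y) = of_real (c\<^sup>2 + y\<^sup>2)"
      by (simp add: complex_eq_iff power2_eq_square)
    have "Complex c y \<noteq> 0" "Complex c (- y) \<noteq> 0" using c by (simp_all add: complex_eq_iff)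
    then have "1 / Complex c y + 1 / Complex c (- y) =
        (Complex c y + Complex c (- y)) / (Complex c y * Complex c (- y))"
      by (simp add: add_divide_distrib)
    also have "Complex c y + Complex c (- y) = of_real (2 * c)"
      by (simp add: complex_eq_iff)
    finally show ?thesis unfolding prod by simp
  qed
  finally have *: "has_bochner_integral lborel (\<lambda>t. f (Complex c y) t + f (Complex c (- y)) (0 + (- 1) * t))
     (complex_of_real (2 * (c / (c\<^sup>2 + y\<^sup>2))))" .
  show ?thesis
  proof (rule has_bochner_integral_cong_AE[THEN iffD1, OF _ _ _ *])
    have "AE t in lborel. t \<noteq> (0::real)" by (rule AE_lborel_singleton)
    then show "AE t in lborel. f (Complex c y) t + f (Complex c (- y)) (0 + (- 1) * t) =
      exp (\<i> * of_real (- (t * y))) * of_real (exp (- (c * \<bar>t\<bar>)))"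
    proof eventually_elim
      case (elim t)
      have "exp (\<i> * of_real (- (t * y))) * of_real (exp (- (c * \<bar>t\<bar>))) =
          exp (\<i> * of_real (- (t * y)) - complex_of_real (c * \<bar>t\<bar>))"
        by (simp add: exp_diff exp_of_real[symmetric] exp_minus field_simps)
      also have "\<dots> = f (Complex c y) t + f (Complex c (- y)) (0 + (- 1) * t)"
      proof (cases "0 < t")
        case True
        then have "\<i> * of_real (- (t * y)) - complex_of_real (c * \<bar>t\<bar>) = - (Complex c y * of_real t)"
          by (simp add: complex_eq_iff)
        with True show ?thesis by (simp add: f_def)
      next
        case False
        then have "\<i> * of_real (- (t * y)) - complex_of_real (c * \<bar>t\<bar>) =
            - (Complex c (- y) * of_real (0 + (- 1) * t))"
          by (simp add: complex_eq_iff)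
        with False elim show ?thesis by (simp add: f_def)
      qed
      finally show ?case by simp
    qed
  qed (simp_all add: f_def)
qed

text \<open>A geometric series in \<open>exp (- 4 \<bar>t\<bar>)\<close>. At \<open>t = 0\<close> every summand vanishes, and so does the quotient
  \<open>0 / 0\<close>, so that no exception is needed there.\<close>
lemma sinh_ratio_sums:
  fixes a t :: real
  shows "(\<lambda>k. exp (- ((4 * real k + (1 - a)) * \<bar>t\<bar>)) - exp (- ((4 * real k + (3 + a)) * \<bar>t\<bar>)))
    sums (sinh (t * (1 + a)) / sinh (2 * t))"
proof (cases "t = 0")
  case True
  then show ?thesis by simp
next
  case False
  define x where "x = \<bar>t\<bar>"
  have x: "0 < x" using False by (simp add: x_def)
  have "norm (exp (- (4 * x))) < 1" using x by simp
  from sums_mult[OF geometric_sums[OF this], of "exp (- ((1 - a) * x)) - exp (- ((3 + a) * x))"]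
  have "(\<lambda>k. (exp (- ((1 - a) * x)) - exp (- ((3 + a) * x))) * exp (- (4 * x)) ^ k)
      sums ((exp (- ((1 - a) * x)) - exp (- ((3 + a) * x))) * (1 / (1 - exp (- (4 * x)))))" .
  also have "(\<lambda>k. (exp (- ((1 - a) * x)) - exp (- ((3 + a) * x))) * exp (- (4 * x)) ^ k) =
      (\<lambda>k. exp (- ((4 * real k + (1 - a)) * x)) - exp (- ((4 * real k + (3 + a)) * x)))"
    by (simp add: fun_eq_iff exp_of_nat_mult[symmetric] left_diff_distrib exp_add[symmetric] algebra_simps)
  also have "(exp (- ((1 - a) * x)) - exp (- ((3 + a) * x))) * (1 / (1 - exp (- (4 * x)))) =
      (exp (2 * x) * (exp (- ((1 - a) * x)) - exp (- ((3 + a) * x)))) / (exp (2 * x) * (1 - exp (- (4 * x))))"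
    by simp
  also have "exp (2 * x) * (exp (- ((1 - a) * x)) - exp (- ((3 + a) * x))) = 2 * sinh (x * (1 + a))"
    by (simp add: sinh_field_def right_diff_distrib exp_add[symmetric] algebra_simps)
  also have "exp (2 * x) * (1 - exp (- (4 * x))) = 2 * sinh (2 * x)"
    by (simp add: sinh_field_def right_diff_distrib exp_add[symmetric])
  also have "2 * sinh (x * (1 + a)) / (2 * sinh (2 * x)) = sinh (t * (1 + a)) / sinh (2 * t)"
    by (cases "0 \<le> t") (simp_all add: x_def)
  finally show ?thesis by (simp add: x_def)
qed

text \<open>The logarithmic derivative of the reflection formula of the Gamma function.\<close>
lemma Digamma_reflection:
  fixes z :: complex
  assumes z: "0 < Re z" "Re z < 1"
  shows "Digamma (1 - z) - Digamma z = of_real pi * cot (of_real pi * z)"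
proof -
  have nz: "z \<notin> \<int>\<^sub>\<le>\<^sub>0" "1 - z \<notin> \<int>\<^sub>\<le>\<^sub>0"
    using z by (auto elim!: nonpos_Ints_cases simp: complex_eq_iff)
  have "((\<lambda>z. rGamma z * rGamma (1 - z)) has_field_derivative
      rGamma z * rGamma (1 - z) * (Digamma (1 - z) - Digamma z)) (at z)"
    using nz by (auto intro!: derivative_eq_intros simp: algebra_simps)
  moreover have "((\<lambda>z. rGamma z * rGamma (1 - z)) has_field_derivative cos (of_real pi * z)) (at z)"
    unfolding rGamma_reflection_complex by (auto intro!: derivative_eq_intros)
  ultimately have "rGamma z * rGamma (1 - z) * (Digamma (1 - z) - Digamma z) = cos (of_real pi * z)"
    by (rule DERIV_unique)
  then have *: "sin (of_real pi * z) / of_real pi * (Digamma (1 - z) - Digamma z) = cos (of_real pi * z)"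
    unfolding rGamma_reflection_complex .
  have "rGamma z * rGamma (1 - z) \<noteq> 0"
    using nz by (simp add: rGamma_eq_zero_iff)
  then have "sin (of_real pi * z) \<noteq> 0" unfolding rGamma_reflection_complex by auto
  with * show ?thesis by (simp add: cot_def field_simps)
qed

lemma cot_sums:
  fixes z :: complex
  assumes z: "0 < Re z" "Re z < 1"
  shows "(\<lambda>k. 1 / (z + of_nat k) - 1 / (1 - z + of_nat k)) sums (of_real pi * cot (of_real pi * z))"
proof -
  have nz: "z \<noteq> 0" "1 - z \<noteq> 0" using z by auto
  have "(\<lambda>k. inverse (of_nat (Suc k)) - inverse (w + of_nat k)) sums (Digamma w + euler_mascheroni)"
    if "w \<noteq> 0" for w :: complex
    using summable_sums[OF summable_Digamma[OF that]] by (simp add: Digamma_def)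
  from sums_diff[OF this[OF nz(2)] this[OF nz(1)]]
  show ?thesis by (simp add: Digamma_reflection[OF z] inverse_eq_divide)
qed

text \<open>The Poisson kernel of the strip \<open>- 1 < Re z < 1\<close> with pole at the boundary point \<open>1 + y \<i>\<close>, evaluated
  at the real point \<open>a\<close>. By reflection, \<open>strip_kernel (- a)\<close> belongs to the boundary line \<open>Re z = - 1\<close>.\<close>
definition strip_kernel :: "real \<Rightarrow> real \<Rightarrow> real" where
  "strip_kernel a y = cos (pi / 2 * a) / (4 * (cosh (pi / 2 * y) - sin (pi / 2 * a)))"

lemma strip_kernel_denom_pos:
  assumes "\<bar>a\<bar> < 1"
  shows "0 < cos (pi / 2 * a)" "0 < cosh (pi / 2 * y) - sin (pi / 2 * a)"
proof -
  have "\<bar>pi / 2 * a\<bar> = pi / 2 * \<bar>a\<bar>" by (simp add: abs_mult)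
  also have "\<dots> < pi / 2 * 1"
    by (rule mult_strict_left_mono[OF assms]) simp
  finally have "\<bar>pi / 2 * a\<bar> < pi / 2 * 1" .
  then have b: "- (pi / 2) < pi / 2 * a" "pi / 2 * a < pi / 2" by linarith+
  show c: "0 < cos (pi / 2 * a)" using b by (intro cos_gt_zero_pi) auto
  have "sin (pi / 2 * a) < sin (pi / 2)"
    using b by (intro sin_monotone_2pi) auto
  then show "0 < cosh (pi / 2 * y) - sin (pi / 2 * a)"
    using cosh_real_ge_1[of "pi / 2 * y"] by simp
qed

lemma Re_cot: "Re (cot (Complex u v)) = sin (2 * u) / (cosh (2 * v) - cos (2 * u))"
proof -
  have s: "sin (Complex u v) = Complex (sin u * cosh v) (cos u * sinh v)"
    by (simp add: complex_eq_iff Re_sin Im_sin cosh_field_def sinh_field_def)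
  have c: "cos (Complex u v) = Complex (cos u * cosh v) (- (sin u * sinh v))"
    by (simp add: complex_eq_iff Re_cos Im_cos cosh_field_def sinh_field_def algebra_simps diff_divide_distrib)
  have ch: "(cosh v)\<^sup>2 = 1 + (sinh v)\<^sup>2" using cosh_square_eq[of v] by simp
  have num: "cos u * cosh v * (sin u * cosh v) + - (sin u * sinh v) * (cos u * sinh v) = sin u * cos u"
  proof -
    have "cos u * cosh v * (sin u * cosh v) + - (sin u * sinh v) * (cos u * sinh v) =
        sin u * cos u * ((cosh v)\<^sup>2 - (sinh v)\<^sup>2)" by (simp add: power2_eq_square algebra_simps)
    then show ?thesis by (simp add: ch)
  qed
  have den: "(sin u * cosh v)\<^sup>2 + (cos u * sinh v)\<^sup>2 = (sin u)\<^sup>2 + (sinh v)\<^sup>2"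
    unfolding power_mult_distrib ch cos_squared_eq by (simp add: algebra_simps)
  have "Re (cot (Complex u v)) = (sin u * cos u) / ((sin u)\<^sup>2 + (sinh v)\<^sup>2)"
    unfolding cot_def s c Re_divide by (simp only: complex.sel num den)
  also have "\<dots> = (2 * (sin u * cos u)) / (2 * ((sin u)\<^sup>2 + (sinh v)\<^sup>2))"
    by (rule mult_divide_mult_cancel_left[symmetric]) simp
  also have "2 * ((sin u)\<^sup>2 + (sinh v)\<^sup>2) = cosh (2 * v) - cos (2 * u)"
    by (simp add: cosh_double cos_double cos_squared_eq ch)
  finally show ?thesis by (simp add: sin_double)
qed

text \<open>Each summand is a quarter of the real part of a summand in the expansion of \<open>pi cot (pi z)\<close> at
  \<open>z = (1 - a + y \<i>) / 4\<close>; the period of the images is 4.\<close>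
lemma strip_kernel_image_sums:
  assumes a: "\<bar>a\<bar> < 1"
  shows "(\<lambda>k. (4 * real k + (1 - a)) / ((4 * real k + (1 - a))\<^sup>2 + y\<^sup>2)
            - (4 * real k + (3 + a)) / ((4 * real k + (3 + a))\<^sup>2 + y\<^sup>2)) sums (pi * strip_kernel a y)"
proof -
  define z where "z = Complex ((1 - a) / 4) (y / 4)"
  have "(\<lambda>k. 1 / (z + of_nat k) - 1 / (1 - z + of_nat k)) sums (of_real pi * cot (of_real pi * z))"
    by (rule cot_sums) (use a in \<open>auto simp: z_def\<close>)
  from sums_Re[OF this]
  have "(\<lambda>k. Re (1 / (z + of_nat k)) - Re (1 / (1 - z + of_nat k))) sums (pi * Re (cot (of_real pi * z)))"
    by simp
  from sums_mult[OF this, of "1 / 4"]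
  have *: "(\<lambda>k. 1 / 4 * (Re (1 / (z + of_nat k)) - Re (1 / (1 - z + of_nat k)))) sums (1 / 4 * (pi * Re (cot (of_real pi * z))))" .
  have summand: "1 / 4 * (Re (1 / (z + of_nat k)) - Re (1 / (1 - z + of_nat k))) =
      (4 * real k + (1 - a)) / ((4 * real k + (1 - a))\<^sup>2 + y\<^sup>2)
      - (4 * real k + (3 + a)) / ((4 * real k + (3 + a))\<^sup>2 + y\<^sup>2)" for k
  proof -
    have R: "1 / 4 * Re (1 / Complex (c / 4) (v / 4)) = c / (c\<^sup>2 + v\<^sup>2)" for c v :: real
    proof -
      have "1 / 4 * Re (1 / Complex (c / 4) (v / 4)) = 1 / 4 * (c / 4 / ((c\<^sup>2 + v\<^sup>2) / 16))"
        by (simp add: Re_divide power_divide add_divide_distrib)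
      also have "\<dots> = c / (c\<^sup>2 + v\<^sup>2)" by simp
      finally show ?thesis .
    qed
    have z1: "z + of_nat k = Complex ((4 * real k + (1 - a)) / 4) (y / 4)"
      "1 - z + of_nat k = Complex ((4 * real k + (3 + a)) / 4) ((- y) / 4)"
      by (simp_all add: z_def complex_eq_iff field_simps)
    show ?thesis
      unfolding right_diff_distrib z1 R by simp
  qed
  have "of_real pi * z = Complex (pi * (1 - a) / 4) (pi * y / 4)"
    by (simp add: z_def complex_eq_iff)
  then have "Re (cot (of_real pi * z)) = sin (2 * (pi * (1 - a) / 4)) / (cosh (2 * (pi * y / 4)) - cos (2 * (pi * (1 - a) / 4)))"
    by (simp only: Re_cot)
  also have "2 * (pi * (1 - a) / 4) = pi / 2 - pi / 2 * a" by (simp add: field_simps)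
  also have "2 * (pi * y / 4) = pi / 2 * y" by simp
  also have "sin (pi / 2 - pi / 2 * a) / (cosh (pi / 2 * y) - cos (pi / 2 - pi / 2 * a)) = 4 * strip_kernel a y"
  proof -
    have "sin (pi / 2 - pi / 2 * a) = cos (pi / 2 * a)" "cos (pi / 2 - pi / 2 * a) = sin (pi / 2 * a)"
      by (simp_all add: sin_diff cos_diff)
    then show ?thesis
      unfolding strip_kernel_def by (simp only: times_divide_eq_right mult_divide_mult_cancel_left_if) simp
  qed
  finally have "1 / 4 * (pi * Re (cot (of_real pi * z))) = pi * strip_kernel a y" by simp
  with * show ?thesis unfolding summand by simp
qed

text \<open>The exponentials are integrated in pairs: a single one has \<open>L\<^sup>1\<close> norm \<open>2 / c\<close>, which is not summable,
  but the difference of two consecutive ones is positive with norm \<open>2 / c - 2 / d\<close>.\<close>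
lemma strip_kernel_Fourier:
  assumes a: "\<bar>a\<bar> < 1"
  defines "\<phi> \<equiv> \<lambda>t. complex_of_real (sinh (t * (1 + a)) / sinh (2 * t))"
  shows "integrable lborel \<phi>"
    and "(CLBINT t. exp (\<i> * of_real (- (t * y))) * \<phi> t) = of_real (2 * pi * strip_kernel a y)"
proof -
  define c where "c k = 4 * real k + (1 - a)" for k
  define d where "d k = 4 * real k + (3 + a)" for k
  have cd: "0 < c k" "0 < d k" "c k \<le> d k" for k
    using a by (auto simp: c_def d_def)
  define f where "f y k t = exp (\<i> * of_real (- (t * y))) * complex_of_real (exp (- (c k * \<bar>t\<bar>)) - exp (- (d k * \<bar>t\<bar>)))"
    for y k t
  have f: "has_bochner_integral lborel (f y k)
      (complex_of_real (2 * (c k / ((c k)\<^sup>2 + y\<^sup>2)) - 2 * (d k / ((d k)\<^sup>2 + y\<^sup>2))))" for y k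
    using has_bochner_integral_diff[OF fourier_exp_abs[OF cd(1)[of k], of y] fourier_exp_abs[OF cd(2)[of k], of y]]
    unfolding f_def by (simp add: right_diff_distrib)
  have le: "exp (- (d k * \<bar>t\<bar>)) \<le> exp (- (c k * \<bar>t\<bar>))" for k t
    using cd(3)[of k] by (simp add: mult_right_mono)
  have norm_f: "norm (f y k t) = exp (- (c k * \<bar>t\<bar>)) - exp (- (d k * \<bar>t\<bar>))" for y k t
    using le[of k t] unfolding f_def norm_mult by (simp only: norm_exp_i_times norm_of_real) simp
  \<comment> \<open>at \<open>y = 0\<close> the pairs are their own absolute values, so the integrals of the norms are a case of \<open>f\<close>\<close>
  have norm_f0: "complex_of_real (norm (f y k t)) = f 0 k t" for y k t
    unfolding norm_f by (simp add: f_def)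
  have f_sums: "(\<lambda>k. f y k t) sums (exp (\<i> * of_real (- (t * y))) * \<phi> t)" for y t
    unfolding f_def \<phi>_def c_def d_def by (intro sums_mult sums_of_real sinh_ratio_sums)
  have summ: "summable (\<lambda>k. norm (f y k t))" for y t
    unfolding norm_f c_def d_def by (rule sums_summable[OF sinh_ratio_sums])
  have norm_int: "(LBINT t. norm (f y k t)) = 2 * (c k / ((c k)\<^sup>2 + 0\<^sup>2) - d k / ((d k)\<^sup>2 + 0\<^sup>2))" for y k
  proof -
    have "complex_of_real (LBINT t. norm (f y k t)) = (CLBINT t. f 0 k t)"
      unfolding integral_complex_of_real[symmetric] norm_f0 ..
    also have "\<dots> = of_real (2 * (c k / ((c k)\<^sup>2 + 0\<^sup>2) - d k / ((d k)\<^sup>2 + 0\<^sup>2)))"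
      using has_bochner_integral_integral_eq[OF f[of 0 k]] by (simp only: right_diff_distrib)
    finally show ?thesis by (simp only: of_real_eq_iff)
  qed
  have summ_int: "summable (\<lambda>k. LBINT t. norm (f y k t))" for y
    unfolding norm_int c_def d_def
    by (intro summable_mult sums_summable[OF strip_kernel_image_sums[OF a]])
  have int: "integrable lborel (f y k)" for y k
    using f by (rule integrable.intros)
  have S: "(\<Sum>k. f y k t) = exp (\<i> * of_real (- (t * y))) * \<phi> t" for y t
    using f_sums by (rule sums_unique[symmetric])
  show "integrable lborel \<phi>"
    using integrable_suminf[OF int[of 0] AE_I2[OF summ[of 0]] summ_int[of 0]] unfolding S by simp
  have "(\<lambda>k. CLBINT t. f y k t) sums (CLBINT t. exp (\<i> * of_real (- (t * y))) * \<phi> t)"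
    using sums_integral[OF int[of y] AE_I2[OF summ[of y]] summ_int[of y]] unfolding S .
  moreover have "(CLBINT t. f y k t) = of_real (2 * (c k / ((c k)\<^sup>2 + y\<^sup>2) - d k / ((d k)\<^sup>2 + y\<^sup>2)))" for k
    using has_bochner_integral_integral_eq[OF f[of y k]] by (simp only: right_diff_distrib)
  moreover have "(\<lambda>k. complex_of_real (2 * (c k / ((c k)\<^sup>2 + y\<^sup>2) - d k / ((d k)\<^sup>2 + y\<^sup>2)))) sums
      of_real (2 * (pi * strip_kernel a y))"
    unfolding c_def d_def by (intro sums_of_real sums_mult strip_kernel_image_sums a)
  ultimately have "(CLBINT t. exp (\<i> * of_real (- (t * y))) * \<phi> t) = of_real (2 * (pi * strip_kernel a y))"
    by (simp only: sums_unique2)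
  then show "(CLBINT t. exp (\<i> * of_real (- (t * y))) * \<phi> t) = of_real (2 * pi * strip_kernel a y)"
    by (simp only: mult.assoc)
qed

lemma sums_alternating_of_pairs:
  fixes f :: "nat \<Rightarrow> real"
  assumes pairs: "(\<lambda>k. f (2 * k) + f (2 * k + 1)) sums s" and lim: "f \<longlonglongrightarrow> 0"
  shows "f sums s"
proof -
  have even: "(\<lambda>n. sum f {..<2 * n}) \<longlonglongrightarrow> s"
  proof -
    have "sum f {..<2 * n} = (\<Sum>k<n. f (2 * k) + f (2 * k + 1))" for n
      by (induction n) auto
    then show ?thesis using pairs by (simp add: sums_def)
  qed
  have odd: "(\<lambda>n. sum f {..<2 * n + 1}) \<longlonglongrightarrow> s"
  proof -
    have "(\<lambda>n. f (2 * n)) \<longlonglongrightarrow> 0"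
      by (rule filterlim_compose[OF lim]) (auto intro!: filterlim_subseq simp: strict_mono_def)
    from tendsto_add[OF even this] show ?thesis by simp
  qed
  have "(\<lambda>n. sum f {..<n}) \<longlonglongrightarrow> s"
    using even odd by (rule limseq_even_odd)
  then show ?thesis by (simp add: sums_def)
qed

lemma strip_kernel_series:
  fixes a y :: real
  assumes a: "\<bar>a\<bar> < 1"
  defines "f \<equiv> \<lambda>j::nat. (- 1) ^ (j + 1) * ((2 * real j - 1) + (- 1) ^ j * a) /
                 (((2 * real j - 1) + (- 1) ^ j * a)\<^sup>2 + y\<^sup>2)"
  shows "(\<lambda>n. f (Suc n)) sums (pi * strip_kernel a y)"
proof (rule sums_alternating_of_pairs)
  have "f (Suc (2 * k)) + f (Suc (2 * k + 1)) = (4 * real k + (1 - a)) / ((4 * real k + (1 - a))\<^sup>2 + y\<^sup>2)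
            - (4 * real k + (3 + a)) / ((4 * real k + (3 + a))\<^sup>2 + y\<^sup>2)" for k
  proof -
    have "2 * real (Suc (2 * k)) - 1 + (- 1) ^ Suc (2 * k) * a = 4 * real k + (1 - a)"
      "2 * real (Suc (2 * k + 1)) - 1 + (- 1) ^ Suc (2 * k + 1) * a = 4 * real k + (3 + a)"
      "(- 1 :: real) ^ (Suc (2 * k) + 1) = 1" "(- 1 :: real) ^ (Suc (2 * k + 1) + 1) = - 1"
      by simp_all
    then show ?thesis
      unfolding f_def by (simp only: mult_1_left mult_minus1 minus_divide_left[symmetric] add_uminus_conv_diff)
  qed
  then show "(\<lambda>k. f (Suc (2 * k)) + f (Suc (2 * k + 1))) sums (pi * strip_kernel a y)"
    using strip_kernel_image_sums[OF a] by simp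
  show "(\<lambda>n. f (Suc n)) \<longlonglongrightarrow> 0"
  proof (rule Lim_null_comparison)
    show "\<forall>\<^sub>F n in sequentially. norm (f (Suc n)) \<le> 1 / real n"
      using eventually_gt_at_top[of 0]
    proof eventually_elim
      case (elim n)
      define c where "c = (2 * real (Suc n) - 1) + (- 1) ^ Suc n * a"
      have "\<bar>(- 1) ^ Suc n * a\<bar> < 1" using a by (simp add: abs_mult power_abs)
      then have c: "real n \<le> c" using elim unfolding c_def by (simp add: abs_less_iff)
      then have c0: "0 < c" using elim by simp
      have "norm (f (Suc n)) = c / (c\<^sup>2 + y\<^sup>2)"
        unfolding f_def c_def[symmetric] using c0 by (simp add: abs_mult power_abs)
      also have "\<dots> \<le> c / c\<^sup>2"
        using c0 by (intro divide_left_mono) (auto simp: add_pos_nonneg)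
      also have "\<dots> = 1 / c" using c0 by (simp add: power2_eq_square)
      also have "\<dots> \<le> 1 / real n" using c elim by (intro divide_left_mono) auto
      finally show ?case .
    qed
    show "(\<lambda>n. 1 / real n) \<longlonglongrightarrow> 0" by (rule lim_1_over_n)
  qed
qed

text \<open>With \<open>t = tan (pi a / 4)\<close>, the half-angle formulas express \<open>cos (pi a / 2)\<close> and \<open>sin (pi a / 2)\<close> by \<open>t\<close>,
  and the two quotients in \<open>tanh (pi y / 4)\<close> are \<open>1 / cosh (pi y / 2)\<close> and \<open>tanh (pi y / 2)\<close>.\<close>
lemma strip_kernel_closed_form:
  fixes a y e :: real
  assumes a: "\<bar>a\<bar> < 1" and e: "e \<in> {1, - 1}"
  shows "strip_kernel (e * a) y =
          1 / cosh (pi / 2 * y) * (1 - (tan (pi / 4 * a))\<^sup>2) /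
          (4 * ((1 - e * (tan (pi / 4 * a) *
                    ((1 - (tanh (pi / 4 * y))\<^sup>2) / (1 + (tanh (pi / 4 * y))\<^sup>2))))\<^sup>2 +
                (tan (pi / 4 * a) *
                    (2 * tanh (pi / 4 * y) / (1 + (tanh (pi / 4 * y))\<^sup>2)))\<^sup>2))"
proof -
  define u where "u = pi / 4 * a"
  define v where "v = pi / 4 * y"
  define t where "t = tan u"
  have dbl: "pi / 2 * a = 2 * u" "pi / 2 * y = 2 * v" "pi / 2 * (e * a) = e * (2 * u)" by (simp_all add: u_def v_def)
  have "\<bar>pi / 4 * a\<bar> = pi / 4 * \<bar>a\<bar>" by (simp add: abs_mult)
  also have "\<dots> < pi / 4 * 1"
    by (rule mult_strict_left_mono[OF a]) simp
  finally have "\<bar>pi / 4 * a\<bar> < pi / 4 * 1" .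
  then have u: "- (pi / 2) < u" "u < pi / 2" using pi_gt_zero unfolding u_def by linarith+
  have cu: "cos u \<noteq> 0" using cos_gt_zero_pi[OF u] by simp
  have t1: "0 < 1 + t\<^sup>2" by (simp add: add_pos_nonneg)
  have cos2: "cos (2 * u) = (1 - t\<^sup>2) / (1 + t\<^sup>2)"
    unfolding t_def by (rule cos_tan_half[OF cu])
  have sin2: "sin (2 * u) = 2 * t / (1 + t\<^sup>2)"
    unfolding t_def by (rule sin_tan_half)
  have C: "1 \<le> cosh (2 * v)" by (rule cosh_real_ge_1)
  have cv: "0 < cosh v" by simp
  have ch: "(cosh v)\<^sup>2 = 1 + (sinh v)\<^sup>2" using cosh_square_eq[of v] by simp
  have dC: "cosh (2 * v) = 1 + 2 * (sinh v)\<^sup>2" by (simp add: cosh_double ch)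
  have "1 + (tanh v)\<^sup>2 = cosh (2 * v) / (cosh v)\<^sup>2" "1 - (tanh v)\<^sup>2 = 1 / (cosh v)\<^sup>2"
    unfolding dC using cv by (simp_all add: tanh_def power_divide field_simps) (simp_all add: ch)
  then have s: "(1 - (tanh v)\<^sup>2) / (1 + (tanh v)\<^sup>2) = 1 / cosh (2 * v)"
    and th: "2 * tanh v / (1 + (tanh v)\<^sup>2) = sinh (2 * v) / cosh (2 * v)"
    using cv C by (simp_all add: tanh_def sinh_double power2_eq_square)
  have ks: "strip_kernel (e * a) y = cos (2 * u) / (4 * (cosh (2 * v) - e * sin (2 * u)))"
    unfolding strip_kernel_def dbl using e by auto
  define D where "D = cosh (2 * v) * (1 + t\<^sup>2) - e * (2 * t)"
  have h: "(1 + t\<^sup>2) * sin (2 * u) = 2 * t" using t1 by (simp add: sin2)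
  have D_eq: "(1 + t\<^sup>2) * (cosh (2 * v) - e * sin (2 * u)) = D"
    unfolding D_def h[symmetric] by (simp only: algebra_simps)
  have D: "0 < D"
  proof -
    have "0 < cosh (pi / 2 * y) - sin (pi / 2 * (e * a))"
      by (rule strip_kernel_denom_pos) (use a e in auto)
    also have "sin (pi / 2 * (e * a)) = e * sin (2 * u)" unfolding dbl using e by auto
    finally have "0 < cosh (2 * v) - e * sin (2 * u)" unfolding dbl .
    with t1 have "0 < (1 + t\<^sup>2) * (cosh (2 * v) - e * sin (2 * u))" by (rule mult_pos_pos)
    also note D_eq
    finally show ?thesis .
  qed
  have den: "(1 - e * (t * (1 / cosh (2 * v))))\<^sup>2 + (t * (sinh (2 * v) / cosh (2 * v)))\<^sup>2 = D / cosh (2 * v)"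
  proof -
    have sh: "(sinh (2 * v))\<^sup>2 = (cosh (2 * v))\<^sup>2 - 1" using cosh_square_eq[of "2 * v"] by simp
    have "(1 - e * (t * (1 / cosh (2 * v))))\<^sup>2 + (t * (sinh (2 * v) / cosh (2 * v)))\<^sup>2 =
        ((cosh (2 * v) - e * t)\<^sup>2 + t\<^sup>2 * (sinh (2 * v))\<^sup>2) / (cosh (2 * v))\<^sup>2"
      using C by (simp add: field_simps power2_eq_square)
    also have "(cosh (2 * v) - e * t)\<^sup>2 + t\<^sup>2 * (sinh (2 * v))\<^sup>2 = cosh (2 * v) * D"
      unfolding sh D_def using e by (auto simp: power2_eq_square algebra_simps)
    finally show ?thesis using C by (simp add: power2_eq_square)
  qed
  have "strip_kernel (e * a) y = (1 - t\<^sup>2) / (4 * D)"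
  proof -
    have "cosh (2 * v) - e * sin (2 * u) = D / (1 + t\<^sup>2)"
      unfolding D_eq[symmetric] using t1 by simp
    then show ?thesis unfolding ks cos2 using t1 by simp
  qed
  also have "\<dots> = 1 / cosh (2 * v) * (1 - t\<^sup>2) / (4 * (D / cosh (2 * v)))"
    using C D by simp
  finally show ?thesis
    unfolding u_def[symmetric] v_def[symmetric] t_def[symmetric] s th den dbl .
qed

section \<open>Fourier inversion for integrable characteristic functions\<close>

lemma iexp_integral:
  fixes a b t :: real
  assumes "a \<le> b" "t \<noteq> 0"
  shows "(CLBINT y. indicator {a..b} y *\<^sub>R exp (\<i> * of_real (- (t * y)))) =
    (iexp (- (t * a)) - iexp (- (t * b))) / (\<i> * t)"
proof -
  have "(CLBINT y=a..b. exp (\<i> * of_real (- (t * y)))) =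
      - exp (\<i> * of_real (- (t * b))) / (\<i> * t) - (- exp (\<i> * of_real (- (t * a))) / (\<i> * t))"
    using assms
    by (intro interval_integral_FTC_finite)
      (auto intro!: continuous_intros derivative_eq_intros has_vector_derivative_real_field
        simp: mult.commute mult.left_commute)
  then show ?thesis
    using assms(1) by (simp add: interval_integral_Icc set_lebesgue_integral_def diff_divide_distrib)
qed

text \<open>Integrability removes the truncation in Levy's formula by dominated convergence; its quotient is the
  integral of \<open>exp (- \<i> t y)\<close> over \<open>{a..b}\<close>, and the integrals may be exchanged.\<close>
lemma (in real_distribution) Levy_inversion_integrable:
  assumes int: "integrable lborel (char M)"
    and p: "\<And>y. (CLBINT t. exp (\<i> * of_real (- (t * y))) * char M t) = of_real (2 * pi * p y)"
    and ab: "a \<le> b" "measure M {a} = 0" "measure M {b} = 0"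
  shows "measure M {a<..b} = (LBINT y. indicator {a..b} y * p y)"
proof -
  let ?G = "\<lambda>t. (iexp (- (t * a)) - iexp (- (t * b))) / (\<i> * t) * char M t"
  have [measurable]: "char M \<in> borel_measurable borel" using int by auto
  have G_bound: "cmod (?G t) \<le> (b - a) * cmod (char M t)" for t
  proof (cases "t = 0")
    case True
    then show ?thesis using ab(1) by simp
  next
    case False
    have "cmod ((iexp (t * (- a)) - iexp (t * (- b))) / (\<i> * t)) \<le> - a - - b"
      by (rule Levy_Inversion_aux2) (use ab(1) False in auto)
    then show ?thesis unfolding norm_mult by (intro mult_right_mono) auto
  qed
  have intb: "integrable lborel (\<lambda>t. (b - a) * cmod (char M t))"
    by (intro integrable_mult_right integrable_norm int)
  have G_meas[measurable]: "?G \<in> borel_measurable lborel" by measurable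
  have lim: "(\<lambda>T::nat. CLBINT t=- ereal (real T)..ereal (real T). ?G t) \<longlonglongrightarrow> (CLBINT t. ?G t)"
  proof -
    have eq: "(CLBINT t=- ereal (real T)..ereal (real T). ?G t) = (CLBINT t. indicator {- real T<..<real T} t *\<^sub>R ?G t)" for T :: nat
      by (simp add: interval_lebesgue_integral_def set_lebesgue_integral_def einterval_eq)
    show ?thesis
      unfolding eq
    proof (rule integral_dominated_convergence[OF _ _ intb])
      show "AE t in lborel. (\<lambda>T::nat. indicator {- real T<..<real T} t *\<^sub>R ?G t) \<longlonglongrightarrow> ?G t"
      proof (rule AE_I2, rule tendsto_eventually)
        fix t :: real
        obtain N :: nat where "\<bar>t\<bar> < real N" using reals_Archimedean2 by blast
        then have "\<forall>\<^sub>F T in sequentially. \<bar>t\<bar> < real T"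
          by (intro eventually_sequentiallyI[of N]) simp
        then show "\<forall>\<^sub>F T in sequentially. indicator {- real T<..<real T} t *\<^sub>R ?G t = ?G t"
          by eventually_elim (simp add: abs_less_iff)
      qed
      show "AE t in lborel. cmod (indicator {- real T<..<real T} t *\<^sub>R ?G t) \<le> (b - a) * cmod (char M t)" for T :: nat
        using G_bound order_trans[OF norm_ge_zero G_bound] by (intro AE_I2) (simp add: indicator_def)
    qed auto
  qed
  have "(\<lambda>T::nat. 1 / (2 * pi) * (CLBINT t=- ereal (real T)..ereal (real T). ?G t)) \<longlonglongrightarrow> of_real (measure M {a<..b})"
    using Levy_Inversion[OF ab] by simp
  moreover have "(\<lambda>T::nat. 1 / (2 * pi) * (CLBINT t=- ereal (real T)..ereal (real T). ?G t)) \<longlonglongrightarrow> 1 / (2 * pi) * (CLBINT t. ?G t)"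
    by (intro tendsto_mult tendsto_const lim)
  ultimately have 1: "of_real (measure M {a<..b}) = 1 / (2 * pi) * (CLBINT t. ?G t)"
    by (rule LIMSEQ_unique)
  let ?K = "\<lambda>t y. indicator {a..b} y *\<^sub>R (exp (\<i> * of_real (- (t * y))) * char M t)"
  have "(CLBINT t. ?G t) = (CLBINT t. CLBINT y. ?K t y)"
  proof (rule integral_cong_AE)
    have "AE t in lborel. t \<noteq> (0::real)" by (rule AE_lborel_singleton)
    then show "AE t in lborel. ?G t = (CLBINT y. ?K t y)"
    proof eventually_elim
      case (elim t)
      have "(CLBINT y. ?K t y) = (CLBINT y. indicator {a..b} y *\<^sub>R exp (\<i> * of_real (- (t * y)))) * char M t"
        by (subst integral_mult_left_zero[symmetric]) simp
      then show ?case by (simp only: iexp_integral[OF ab(1) elim])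
    qed
  qed measurable
  also have "\<dots> = (CLBINT y. CLBINT t. ?K t y)"
  proof (rule lborel_pair.Fubini_integral[symmetric], rule lborel_pair.Fubini_integrable)
    have n: "cmod (?K t y) = indicator {a..b} y * cmod (char M t)" for t y
      by (simp add: norm_mult norm_exp_i_times del: of_real_minus of_real_mult)
    have "(LBINT y. cmod (?K t y)) = (b - a) * cmod (char M t)" for t
      unfolding n using ab(1) by simp
    then show "integrable lborel (\<lambda>t. LBINT y. norm (case (t, y) of (t, y) \<Rightarrow> ?K t y))"
      using intb by simp
    show "AE t in lborel. integrable lborel (\<lambda>y. case (t, y) of (t, y) \<Rightarrow> ?K t y)"
    proof (rule AE_I2)
      fix t
      have "integrable lborel (\<lambda>y. indicator {a..b} y *\<^sub>R (exp (\<i> * of_real (- (t * y))) * char M t))"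
        by (intro borel_integrable_compact continuous_intros) auto
      then show "integrable lborel (\<lambda>y. case (t, y) of (t, y) \<Rightarrow> ?K t y)" by simp
    qed
  qed measurable
  also have "\<dots> = (CLBINT y. of_real (2 * pi * (indicator {a..b} y * p y)))"
    by (intro Bochner_Integration.integral_cong refl)
      (simp add: p indicator_def del: of_real_minus of_real_mult split: if_splits)
  also have "\<dots> = of_real (2 * pi * (LBINT y. indicator {a..b} y * p y))"
    by (simp only: integral_complex_of_real integral_mult_right_zero)
  finally have "of_real (measure M {a<..b}) = complex_of_real (1 / (2 * pi) * (2 * pi * (LBINT y. indicator {a..b} y * p y)))"
    unfolding 1 by simp
  then show ?thesis unfolding of_real_eq_iff by simp
qed

text \<open>Levy's formula only speaks of intervals whose end points are not atoms. Such points are dense, and both the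
  distribution function and an antiderivative of \<open>p\<close> are right-continuous.\<close>
lemma (in real_distribution) density_of_integrable_char:
  assumes int: "integrable lborel (char M)"
    and p: "\<And>y. (CLBINT t. exp (\<i> * of_real (- (t * y))) * char M t) = of_real (2 * pi * p y)"
    and p_cont: "continuous_on UNIV p" and p_nonneg: "\<And>y. 0 \<le> p y"
  shows "M = density lborel (\<lambda>y. ennreal (p y))"
proof -
  have isCont: "isCont p y" for y using p_cont by (simp add: continuous_on_eq_continuous_at)
  have [measurable]: "p \<in> borel_measurable borel" by (rule borel_measurable_continuous_onI[OF p_cont])
  obtain F where "\<forall>y::real. - \<infinity> < ereal y \<longrightarrow> ereal y < \<infinity> \<longrightarrow> (F has_vector_derivative p y) (at y)"
    using einterval_antiderivative[of "- \<infinity>" "\<infinity>" p] isCont by auto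
  then have F: "DERIV F y :> p y" for y
    by (simp add: has_real_derivative_iff_has_vector_derivative)
  have nnF: "(\<integral>\<^sup>+y. ennreal (p y) * indicator {a..b} y \<partial>lborel) = ennreal (F b - F a)" if "a \<le> b" for a b
    by (rule nn_integral_FTC_Icc) (use F that p_nonneg in auto)
  have Fmono: "F a \<le> F b" if "a \<le> b" for a b
    using that F p_nonneg by (auto intro: DERIV_nonneg_imp_nondecreasing)
  define D where "D y = cdf M y - F y" for y
  have D_eq: "D a = D b" if ab: "a \<le> b" "measure M {a} = 0" "measure M {b} = 0" for a b
  proof (cases "a = b")
    case False
    have "(LBINT y. indicator {a..b} y * p y) = F b - F a"
      using nnF[OF ab(1)] Fmono[OF ab(1)] p_nonneg
      by (subst integral_eq_nn_integral) (auto simp: ennreal_mult' mult.commute ennreal_indicator[symmetric] simp del: ennreal_indicator)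
    then have "measure M {a<..b} = F b - F a"
      using Levy_inversion_integrable[OF int p ab] by simp
    then show ?thesis using False ab cdf_diff_eq[of a b] by (simp add: D_def)
  qed simp
  have count: "countable {y. measure M {y} \<noteq> 0}" by (rule countable_support)
  obtain c where c: "measure M {c} = 0"
    using open_minus_countable[OF count, of UNIV] by auto
  have D_c: "D y = D c" if "measure M {y} = 0" for y
    using D_eq[of y c] D_eq[of c y] c that by linarith
  have D_const: "D x = D c" for x
  proof (rule ccontr)
    assume ne: "D x \<noteq> D c"
    have "(F \<longlongrightarrow> F x) (at_right x)"
      using DERIV_isCont[OF F] unfolding isCont_def by (rule tendsto_within_subset) simp
    then have "(D \<longlongrightarrow> D x) (at_right x)"
      unfolding D_def using cdf_is_right_cont[of x] by (intro tendsto_diff) (auto simp: continuous_within)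
    then have "\<forall>\<^sub>F y in at_right x. D y \<noteq> D c"
      by (rule tendsto_imp_eventually_ne[OF _ ne])
    then obtain b where b: "b > x" "\<And>y. x < y \<Longrightarrow> y < b \<Longrightarrow> D y \<noteq> D c"
      by (auto simp: eventually_at_right[OF less_add_one])
    with open_minus_countable[OF count, of "{x<..<b}"] obtain y where "x < y" "y < b" "measure M {y} = 0"
      by auto
    with b(2) D_c show False by blast
  qed
  have Ioc: "emeasure M {a<..b} = emeasure (density lborel (\<lambda>y. ennreal (p y))) {a<..b}" if "a \<le> b" for a b
  proof -
    have "AE y in lborel. y \<noteq> a" by (rule AE_lborel_singleton)
    then have "emeasure (density lborel (\<lambda>y. ennreal (p y))) {a<..b} =
        (\<integral>\<^sup>+y. ennreal (p y) * indicator {a..b} y \<partial>lborel)"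
      by (subst emeasure_density) (auto intro!: nn_integral_cong_AE elim!: eventually_mono split: split_indicator)
    also have "\<dots> = ennreal (F b - F a)" by (rule nnF[OF that])
    also have "F b - F a = cdf M b - cdf M a"
      using D_const[of a] D_const[of b] by (simp add: D_def)
    finally show ?thesis using emeasure_Ioc[OF that] by simp
  qed
  show ?thesis
  proof (rule measure_eqI_generator_eq[where \<Omega> = UNIV])
    fix X assume "X \<in> range (\<lambda>(a, b). {a<..b::real})"
    then obtain a b where "X = {a<..b}" by auto
    then show "emeasure M X = emeasure (density lborel (\<lambda>y. ennreal (p y))) X"
      by (cases "a \<le> b") (simp_all add: Ioc)
  next
    show "(\<Union>i. {- real (i::nat)<..real i}) = UNIV"
      by (rule UN_Ioc_eq_UNIV)
  qed (auto simp: borel_sigma_sets_Ioc Int_stable_def)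
qed

text \<open>This is inversion for the law of \<open>Y\<close> conditioned on the event \<open>E\<close>. The transform is only prescribed
  away from \<open>t = 0\<close>, where its value would be the probability of \<open>E\<close>; a single point does not affect the
  inverse transform.\<close>
lemma (in prob_space) density_of_event_Fourier:
  fixes Y :: "'a \<Rightarrow> real" and \<phi> :: "real \<Rightarrow> complex"
  assumes E[measurable]: "Measurable.pred M E" and Y[measurable]: "Y \<in> borel_measurable M"
    and char_E: "\<And>t. t \<noteq> 0 \<Longrightarrow> expectation (\<lambda>\<omega>. of_bool (E \<omega>) * exp (\<i> * of_real (t * Y \<omega>))) = \<phi> t"
    and int: "integrable lborel \<phi>"
    and p: "\<And>y. (CLBINT t. exp (\<i> * of_real (- (t * y))) * \<phi> t) = of_real (2 * pi * p y)"
    and p_cont: "continuous_on UNIV p" and p_nonneg: "\<And>y. 0 \<le> p y"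
    and A[measurable]: "A \<in> sets borel"
  shows "emeasure M {\<omega> \<in> space M. E \<omega> \<and> Y \<omega> \<in> A} = (\<integral>\<^sup>+y. ennreal (p y) * indicator A y \<partial>lborel)"
proof -
  have [measurable]: "p \<in> borel_measurable borel"
    by (rule borel_measurable_continuous_onI[OF p_cont])
  have AE0: "AE t in lborel. t \<noteq> (0::real)" by (rule AE_lborel_singleton)
  define q where "q = prob {\<omega> \<in> space M. E \<omega>}"
  have q_expect: "expectation (\<lambda>\<omega>. of_bool (E \<omega>)) = q"
  proof -
    have "expectation (\<lambda>\<omega>. of_bool (E \<omega>)) = expectation (indicat_real {\<omega> \<in> space M. E \<omega>})"
      by (intro Bochner_Integration.integral_cong) (auto simp: indicator_def)
    then show ?thesis by (simp add: q_def)
  qed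
  show ?thesis
  proof (cases "q = 0")
    case True
    then have AE: "AE \<omega> in M. \<not> E \<omega>"
      unfolding q_def by (subst (asm) prob_eq_0) auto
    have "\<phi> t = 0" if "t \<noteq> 0" for t
    proof -
      have "expectation (\<lambda>\<omega>. of_bool (E \<omega>) * exp (\<i> * of_real (t * Y \<omega>))) = expectation (\<lambda>_. 0 :: complex)"
        by (rule integral_cong_AE) (use AE in \<open>auto elim!: eventually_mono\<close>)
      then show ?thesis using char_E[OF that] by simp
    qed
    then have "(CLBINT t. exp (\<i> * of_real (- (t * y))) * \<phi> t) = (CLBINT t::real. 0)" for y
      using int AE0 by (intro integral_cong_AE) (auto elim!: eventually_mono)
    then have "p y = 0" for y using p[of y] by simp
    moreover have "emeasure M {\<omega> \<in> space M. E \<omega> \<and> Y \<omega> \<in> A} = 0"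
      using AE by (intro emeasure_eq_0_AE) (auto elim!: eventually_mono)
    ultimately show ?thesis by simp
  next
    case False
    then have q: "0 < q" unfolding q_def using measure_nonneg[of M] by (simp add: less_le)
    define N where "N = density M (\<lambda>\<omega>. ennreal (of_bool (E \<omega>) / q))"
    have bool_int: "integrable M (\<lambda>\<omega>. of_bool (E \<omega>) / q :: real)"
      by (rule integrable_const_bound[where B = "1 / q"]) (use q in \<open>auto simp: divide_right_mono\<close>)
    have "emeasure N (space N) = (\<integral>\<^sup>+\<omega>. ennreal (of_bool (E \<omega>) / q) \<partial>M)"
      unfolding N_def by (simp add: emeasure_density cong: nn_integral_cong)
    also have "\<dots> = ennreal (expectation (\<lambda>\<omega>. of_bool (E \<omega>) / q))"
      using q by (intro nn_integral_eq_integral bool_int) auto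
    also have "\<dots> = 1" using q by (simp add: q_expect)
    finally have "prob_space N" by (rule prob_spaceI)
    then interpret N: prob_space N .
    have YN[measurable]: "Y \<in> borel_measurable N" unfolding N_def by simp
    interpret D: real_distribution "distr N borel Y" by (rule N.real_distribution_distr[OF YN])
    have char: "char (distr N borel Y) t = \<phi> t / q" if "t \<noteq> 0" for t
    proof -
      have "char (distr N borel Y) t = (CLINT \<omega>|N. exp (\<i> * of_real (t * Y \<omega>)))"
        unfolding char_def by (subst integral_distr) auto
      also have "\<dots> = expectation (\<lambda>\<omega>. (of_bool (E \<omega>) / q) *\<^sub>R exp (\<i> * of_real (t * Y \<omega>)))"
        unfolding N_def using q by (subst integral_density) auto
      also have "\<dots> = expectation (\<lambda>\<omega>. of_bool (E \<omega>) * exp (\<i> * of_real (t * Y \<omega>)) / q)"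
        by (intro Bochner_Integration.integral_cong refl) (auto simp: scaleR_conv_of_real)
      also have "\<dots> = \<phi> t / q" by (simp only: integral_divide_zero char_E[OF that])
      finally show ?thesis .
    qed
    have mchar: "char (distr N borel Y) \<in> borel_measurable lborel" by simp
    have int': "integrable lborel (char (distr N borel Y))"
      by (rule integrable_cong_AE_imp[of _ "\<lambda>t. \<phi> t / q"])
        (use int char AE0 mchar in \<open>auto elim!: eventually_mono\<close>)
    have "distr N borel Y = density lborel (\<lambda>y. ennreal (p y / q))"
    proof (rule D.density_of_integrable_char[OF int'])
      fix y
      have "(CLBINT t. exp (\<i> * of_real (- (t * y))) * char (distr N borel Y) t) =
          (CLBINT t. exp (\<i> * of_real (- (t * y))) * \<phi> t / q)"
        using int mchar AE0 by (intro integral_cong_AE) (auto elim!: eventually_mono simp: char)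
      also have "\<dots> = of_real (2 * pi * (p y / q))"
        unfolding integral_divide_zero p by simp
      finally show "(CLBINT t. exp (\<i> * of_real (- (t * y))) * char (distr N borel Y) t) = of_real (2 * pi * (p y / q))" .
    qed (use p_cont p_nonneg q in \<open>auto intro!: continuous_intros\<close>)
    then have "emeasure (distr N borel Y) A = (\<integral>\<^sup>+y. ennreal (p y / q) * indicator A y \<partial>lborel)"
      by (subst \<open>distr N borel Y = _\<close>, subst emeasure_density) auto
    also have "\<dots> = (\<integral>\<^sup>+y. ennreal (1 / q) * (ennreal (p y) * indicator A y) \<partial>lborel)"
      using q p_nonneg by (intro nn_integral_cong) (simp add: mult.assoc[symmetric] ennreal_mult[symmetric])
    also have "\<dots> = ennreal (1 / q) * (\<integral>\<^sup>+y. ennreal (p y) * indicator A y \<partial>lborel)"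
      by (intro nn_integral_cmult) measurable
    finally have 1: "emeasure (distr N borel Y) A = ennreal (1 / q) * (\<integral>\<^sup>+y. ennreal (p y) * indicator A y \<partial>lborel)" .
    have "emeasure (distr N borel Y) A = emeasure N {\<omega> \<in> space M. Y \<omega> \<in> A}"
      by (subst emeasure_distr) (auto simp: N_def vimage_def Int_def conj_commute)
    also have "\<dots> = (\<integral>\<^sup>+\<omega>. ennreal (of_bool (E \<omega>) / q) * indicator {\<omega> \<in> space M. Y \<omega> \<in> A} \<omega> \<partial>M)"
      unfolding N_def by (subst emeasure_density) auto
    also have "\<dots> = (\<integral>\<^sup>+\<omega>. ennreal (1 / q) * indicator {\<omega> \<in> space M. E \<omega> \<and> Y \<omega> \<in> A} \<omega> \<partial>M)"
      by (intro nn_integral_cong) (auto simp: indicator_def)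
    also have "\<dots> = ennreal (1 / q) * emeasure M {\<omega> \<in> space M. E \<omega> \<and> Y \<omega> \<in> A}"
      by (rule nn_integral_cmult_indicator) auto
    finally have "ennreal q * (ennreal (1 / q) * emeasure M {\<omega> \<in> space M. E \<omega> \<and> Y \<omega> \<in> A}) =
        ennreal q * (ennreal (1 / q) * (\<integral>\<^sup>+y. ennreal (p y) * indicator A y \<partial>lborel))"
      unfolding 1 by simp
    moreover have "ennreal q * ennreal (1 / q) = 1" using q by (simp add: ennreal_mult[symmetric])
    ultimately show ?thesis by (simp add: mult.assoc[symmetric])
  qed
qed

section \<open>The exit density\<close>

lemma nn_integral_strip_arclength:
  assumes [measurable]: "f \<in> borel_measurable borel"
  shows "(\<integral>\<^sup>+z. f z \<partial>strip_arclength) =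
    (\<integral>\<^sup>+y. f (Complex 1 y) \<partial>lborel) + (\<integral>\<^sup>+y. f (Complex (- 1) y) \<partial>lborel)"
proof -
  let ?P = "count_space {- 1, 1 :: real} \<Otimes>\<^sub>M (lborel :: real measure)"
  have sec: "(\<lambda>y. Complex x y) \<in> borel_measurable borel" for x
    by (intro borel_measurable_continuous_onI) (auto intro!: continuous_intros simp: Complex_eq)
  have m: "(\<lambda>(x, y). Complex x y) \<in> measurable ?P borel"
    by (rule measurable_pair_measure_countable1) (use sec in auto)
  have "(\<integral>\<^sup>+z. f z \<partial>strip_arclength) = (\<integral>\<^sup>+v. f (case v of (x, y) \<Rightarrow> Complex x y) \<partial>?P)"
    unfolding strip_arclength_def by (rule nn_integral_distr[OF m]) simp
  also have "\<dots> = (\<integral>\<^sup>+x. \<integral>\<^sup>+y. f (Complex x y) \<partial>lborel \<partial>count_space {- 1, 1})"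
    using lborel.nn_integral_fst[OF measurable_compose[OF m assms]] by simp
  also have "\<dots> = (\<integral>\<^sup>+y. f (Complex 1 y) \<partial>lborel) + (\<integral>\<^sup>+y. f (Complex (- 1) y) \<partial>lborel)"
    by (subst nn_integral_count_space_finite) (auto simp: add.commute)
  finally show ?thesis .
qed

lemma exit_time_strip: "exit_time B strip \<omega> = hit_time (\<lambda>t. Re (B t \<omega>))"
proof -
  have "B t \<omega> \<notin> strip \<longleftrightarrow> 1 \<le> \<bar>Re (B t \<omega>)\<bar>" for t
    unfolding strip_def by auto
  then show ?thesis by (simp add: exit_time_def hit_time_def)
qed

lemma strip_kernel_nonneg: "\<bar>a\<bar> < 1 \<Longrightarrow> 0 \<le> strip_kernel a y"
  using strip_kernel_denom_pos(1)[of a] strip_kernel_denom_pos(2)[of a y] by (simp add: strip_kernel_def)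

lemma strip_kernel_continuous: "\<bar>a\<bar> < 1 \<Longrightarrow> continuous_on S (strip_kernel a)"
  unfolding strip_kernel_def
  using strip_kernel_denom_pos by (intro continuous_intros) (auto simp: less_le)

context planar_brownian_motion
begin

lemma exit_side_density:
  assumes a: "Im a = 0" "\<bar>Re a\<bar> < 1" and e: "e \<in> {1, - 1}" and A: "A \<in> sets borel"
  shows "emeasure M {\<omega> \<in> space M. Re (B (re.\<tau> \<omega>) \<omega>) = e \<and> Im (B (re.\<tau> \<omega>) \<omega>) \<in> A} =
    (\<integral>\<^sup>+y. ennreal (strip_kernel (e * Re a) y) * indicator A y \<partial>lborel)"
proof (rule density_of_event_Fourier[OF _ _ exit_side_Fourier[OF a e] _ _ _ _ A])
  have ea: "\<bar>e * Re a\<bar> < 1" using a(2) e by auto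
  have [measurable]: "(\<lambda>\<omega>. Re (B (re.\<tau> \<omega>) \<omega>)) \<in> borel_measurable M"
    by (rule re.position_measurable) auto
  show "Measurable.pred M (\<lambda>\<omega>. Re (B (re.\<tau> \<omega>) \<omega>) = e)" by measurable
  show "(\<lambda>\<omega>. Im (B (re.\<tau> \<omega>) \<omega>)) \<in> borel_measurable M"
    by (rule im.position_measurable) auto
  show "integrable lborel (\<lambda>t. complex_of_real (sinh (t * (1 + e * Re a)) / sinh (2 * t)))"
    by (rule strip_kernel_Fourier(1)[OF ea])
  show "(CLBINT t. exp (\<i> * of_real (- (t * y))) * complex_of_real (sinh (t * (1 + e * Re a)) / sinh (2 * t))) =
      of_real (2 * pi * strip_kernel (e * Re a) y)" for y
    by (rule strip_kernel_Fourier(2)[OF ea])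
  show "continuous_on UNIV (strip_kernel (e * Re a))" by (rule strip_kernel_continuous[OF ea])
  show "0 \<le> strip_kernel (e * Re a) y" for y by (rule strip_kernel_nonneg[OF ea])
qed

lemma strip_exit_density:
  assumes a: "Im a = 0" "\<bar>Re a\<bar> < 1"
  shows "is_exit_density M B strip strip_arclength
    (\<lambda>z. if Re z = 1 then strip_kernel (Re a) (Im z) else strip_kernel (- Re a) (Im z))"
    (is "is_exit_density M B strip strip_arclength ?\<rho>")
  unfolding is_exit_density_def
proof (intro conjI allI)
  have pos: "exit_position B strip = (\<lambda>\<omega>. B (re.\<tau> \<omega>) \<omega>)"
    by (simp add: fun_eq_iff exit_position_def exit_time_strip re.\<tau>_def)
  have a': "\<bar>- Re a\<bar> < 1" using a by simp
  show "AE \<omega> in M. exit_time B strip \<omega> < \<infinity>"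
    unfolding exit_time_strip by (rule re.T_finite)
  show "0 \<le> ?\<rho> z" for z
    using strip_kernel_nonneg[OF a(2)] strip_kernel_nonneg[OF a'] by simp
  have [measurable]: "strip_kernel (Re a) \<in> borel_measurable borel" "strip_kernel (- Re a) \<in> borel_measurable borel"
    by (rule borel_measurable_continuous_onI, rule strip_kernel_continuous, fact)+
  have \<rho>[measurable]: "?\<rho> \<in> borel_measurable borel" by measurable
  have re[measurable]: "(\<lambda>\<omega>. Re (B (re.\<tau> \<omega>) \<omega>)) \<in> borel_measurable M"
    by (rule re.position_measurable) auto
  have im[measurable]: "(\<lambda>\<omega>. Im (B (re.\<tau> \<omega>) \<omega>)) \<in> borel_measurable M"
    by (rule im.position_measurable) auto
  have B[measurable]: "(\<lambda>\<omega>. B (re.\<tau> \<omega>) \<omega>) \<in> borel_measurable M"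
    unfolding borel_measurable_complex_iff using re im by blast
  have sets: "sets strip_arclength = sets borel" by (simp add: strip_arclength_def)
  have line[measurable]: "(\<lambda>y. Complex x y) \<in> borel_measurable borel" for x
    by (intro borel_measurable_continuous_onI) (auto intro!: continuous_intros simp: Complex_eq)
  show "distributed M strip_arclength (exit_position B strip) (\<lambda>z. ennreal (?\<rho> z))"
    unfolding distributed_def pos
  proof (intro conjI)
    show "(\<lambda>\<omega>. B (re.\<tau> \<omega>) \<omega>) \<in> measurable M strip_arclength"
      using B by (simp add: measurable_cong_sets[OF refl sets])
    show \<rho>': "(\<lambda>z. ennreal (?\<rho> z)) \<in> borel_measurable strip_arclength"
      unfolding measurable_cong_sets[OF sets refl] by measurable
    show "distr M strip_arclength (\<lambda>\<omega>. B (re.\<tau> \<omega>) \<omega>) = density strip_arclength (\<lambda>z. ennreal (?\<rho> z))"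
    proof (rule measure_eqI)
      fix A assume "A \<in> sets (distr M strip_arclength (\<lambda>\<omega>. B (re.\<tau> \<omega>) \<omega>))"
      then have A[measurable]: "A \<in> sets borel" by (simp add: sets)
      define S where "S e = {y. Complex e y \<in> A}" for e
      have S[measurable]: "S e \<in> sets borel" for e
        using measurable_sets[OF line A] by (simp add: S_def vimage_def)
      define E where "E e = {\<omega> \<in> space M. Re (B (re.\<tau> \<omega>) \<omega>) = e \<and> Im (B (re.\<tau> \<omega>) \<omega>) \<in> S e}" for e
      have E[measurable]: "E e \<in> sets M" for e unfolding E_def by measurable
      have "emeasure (distr M strip_arclength (\<lambda>\<omega>. B (re.\<tau> \<omega>) \<omega>)) A = emeasure M {\<omega> \<in> space M. B (re.\<tau> \<omega>) \<omega> \<in> A}"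
        using B by (subst emeasure_distr)
          (auto simp: sets measurable_cong_sets[OF refl sets] vimage_def Int_def conj_commute)
      also have "\<dots> = emeasure M (E 1 \<union> E (- 1))"
      proof (rule emeasure_eq_AE)
        show "AE \<omega> in M. \<omega> \<in> {\<omega> \<in> space M. B (re.\<tau> \<omega>) \<omega> \<in> A} \<longleftrightarrow> \<omega> \<in> E 1 \<union> E (- 1)"
          using exit_boundary[OF a(2)]
        proof eventually_elim
          case (elim \<omega>)
          define w where "w = B (re.\<tau> \<omega>) \<omega>"
          have w: "Re w = 1 \<Longrightarrow> Complex 1 (Im w) = w" "Re w = - 1 \<Longrightarrow> Complex (- 1) (Im w) = w"
            by (simp_all add: complex_eq_iff)
          have "Re w = 1 \<or> Re w = - 1" using elim unfolding w_def by linarith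
          then have "w \<in> A \<longleftrightarrow> Re w = 1 \<and> Complex 1 (Im w) \<in> A \<or> Re w = - 1 \<and> Complex (- 1) (Im w) \<in> A"
            using w by auto
          then show ?case unfolding w_def E_def S_def by blast
        qed
      qed (use E in auto)
      also have "\<dots> = emeasure M (E 1) + emeasure M (E (- 1))"
        by (rule plus_emeasure[OF E E, symmetric]) (auto simp: E_def)
      also have "\<dots> = (\<integral>\<^sup>+y. ennreal (strip_kernel (1 * Re a) y) * indicator (S 1) y \<partial>lborel)
          + (\<integral>\<^sup>+y. ennreal (strip_kernel ((- 1) * Re a) y) * indicator (S (- 1)) y \<partial>lborel)"
        unfolding E_def by (intro arg_cong2[where f = plus] exit_side_density[OF a] S) auto
      also have "\<dots> = (\<integral>\<^sup>+z. ennreal (?\<rho> z) * indicator A z \<partial>strip_arclength)"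
        by (subst nn_integral_strip_arclength) (simp_all add: S_def indicator_def)
      also have "\<dots> = emeasure (density strip_arclength (\<lambda>z. ennreal (?\<rho> z))) A"
        using \<rho>' A by (subst emeasure_density) (auto simp: sets)
      finally show "emeasure (distr M strip_arclength (\<lambda>\<omega>. B (re.\<tau> \<omega>) \<omega>)) A =
        emeasure (density strip_arclength (\<lambda>z. ennreal (?\<rho> z))) A" .
    qed simp
  qed
qed

end

theorem mainTheorem5:
  fixes M :: "'a measure" and B :: "real \<Rightarrow> 'a \<Rightarrow> complex" and a :: real
  assumes "- 1 < a" and "a < 1"
    and "planar_brownian_motion M B (complex_of_real a)"
  shows "\<exists>\<rho> :: complex \<Rightarrow> real. is_exit_density M B strip strip_arclength \<rho> \<and>
    (\<forall>y::real.
      (let f = (\<lambda>j::nat. (- 1) ^ (j + 1) * ((2 * real j - 1) + (- 1) ^ j * a) /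
                 (((2 * real j - 1) + (- 1) ^ j * a)\<^sup>2 + y\<^sup>2))
       in summable (\<lambda>n. f (Suc n)) \<and> \<rho> (Complex 1 y) = 1 / pi * (\<Sum>n. f (Suc n))) \<and>
      (let g = (\<lambda>j::nat. (- 1) ^ (j + 1) * ((2 * real j - 1) - (- 1) ^ j * a) /
                 (((2 * real j - 1) - (- 1) ^ j * a)\<^sup>2 + y\<^sup>2))
       in summable (\<lambda>n. g (Suc n)) \<and> \<rho> (Complex (- 1) y) = 1 / pi * (\<Sum>n. g (Suc n))) \<and>
      (\<forall>e\<in>{1, - 1}.
        \<rho> (Complex e y) =
          1 / cosh (pi / 2 * y) * (1 - (tan (pi / 4 * a))\<^sup>2) /
          (4 * ((1 - e * (tan (pi / 4 * a) *
                    ((1 - (tanh (pi / 4 * y))\<^sup>2) / (1 + (tanh (pi / 4 * y))\<^sup>2))))\<^sup>2 +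
                (tan (pi / 4 * a) *
                    (2 * tanh (pi / 4 * y) / (1 + (tanh (pi / 4 * y))\<^sup>2)))\<^sup>2))))"
proof -
  interpret planar_brownian_motion M B "complex_of_real a" by fact
  have a: "\<bar>a\<bar> < 1" "\<bar>- a\<bar> < 1" using assms(1,2) by auto
  define \<rho> where "\<rho> z = (if Re z = 1 then strip_kernel a (Im z) else strip_kernel (- a) (Im z))" for z
  have \<rho>: "\<rho> (Complex 1 y) = strip_kernel a y" "\<rho> (Complex (- 1) y) = strip_kernel (- a) y" for y
    by (simp_all add: \<rho>_def)
  have series: "summable h \<and> k = 1 / pi * suminf h" if "h sums (pi * k)" for h k
    using that by (simp add: sums_iff)
  show ?thesis
  proof (rule exI[of _ \<rho>], unfold Let_def, intro conjI allI ballI)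
    show "is_exit_density M B strip strip_arclength \<rho>"
      using strip_exit_density a unfolding \<rho>_def[abs_def] Re_complex_of_real Im_complex_of_real by blast
  next
    fix y :: real
    note plus = series[OF strip_kernel_series[OF a(1), of y]]
    show "summable (\<lambda>n. (- 1) ^ (Suc n + 1) * ((2 * real (Suc n) - 1) + (- 1) ^ Suc n * a) /
        (((2 * real (Suc n) - 1) + (- 1) ^ Suc n * a)\<^sup>2 + y\<^sup>2))"
      by (rule plus[THEN conjunct1])
    show "\<rho> (Complex 1 y) = 1 / pi * (\<Sum>n. (- 1) ^ (Suc n + 1) * ((2 * real (Suc n) - 1) + (- 1) ^ Suc n * a) /
        (((2 * real (Suc n) - 1) + (- 1) ^ Suc n * a)\<^sup>2 + y\<^sup>2))"
      unfolding \<rho> by (rule plus[THEN conjunct2])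
    note minus = series[OF strip_kernel_series[OF a(2), of y], unfolded mult_minus_right add_uminus_conv_diff]
    show "summable (\<lambda>n. (- 1) ^ (Suc n + 1) * ((2 * real (Suc n) - 1) - (- 1) ^ Suc n * a) /
        (((2 * real (Suc n) - 1) - (- 1) ^ Suc n * a)\<^sup>2 + y\<^sup>2))"
      by (rule minus[THEN conjunct1])
    show "\<rho> (Complex (- 1) y) = 1 / pi * (\<Sum>n. (- 1) ^ (Suc n + 1) * ((2 * real (Suc n) - 1) - (- 1) ^ Suc n * a) /
        (((2 * real (Suc n) - 1) - (- 1) ^ Suc n * a)\<^sup>2 + y\<^sup>2))"
      unfolding \<rho> by (rule minus[THEN conjunct2])
  next
    fix y e :: real assume e: "e \<in> {1, - 1}"
    then have "\<rho> (Complex e y) = strip_kernel (e * a) y" using \<rho> by auto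
    then show "\<rho> (Complex e y) =
          1 / cosh (pi / 2 * y) * (1 - (tan (pi / 4 * a))\<^sup>2) /
          (4 * ((1 - e * (tan (pi / 4 * a) *
                    ((1 - (tanh (pi / 4 * y))\<^sup>2) / (1 + (tanh (pi / 4 * y))\<^sup>2))))\<^sup>2 +
                (tan (pi / 4 * a) *
                    (2 * tanh (pi / 4 * y) / (1 + (tanh (pi / 4 * y))\<^sup>2)))\<^sup>2))"
      using strip_kernel_closed_form[OF a(1) e, of y] by simp
  qed
qed

end
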